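(* Let $d\ge1$ be an integer. For any $\vec M\in\mathbb{N}^d$, let $\Omega:=R(\vec M)\cap\mathbb{Z}^d$ and $U\subset\vec M^{-1}\Omega$. For any $\vec\epsilon:\Omega\to\mathbb{R}^d$, define $\Omega':=\{\vec j+\vec\epsilon(\vec j):\vec j\in\Omega\}$ and $\ell:=\|\vec\epsilon\|_\infty$. Let $\boldsymbol{F}(\Omega',U)=\big[e^{2\pi i(\vec j+\vec\epsilon(\vec j))\cdot\vec u}\big]_{\vec j\in\Omega,\,\vec u\in U}$. (a) If $\ell<\frac14$, then the extreme singular values of $\boldsymbol{F}(\Omega',U)$ satisfy $$\sigma_{\min}\ge(1-D(\ell))\sqrt{M_1\cdots M_d}\quad\text{and}\quad\sigma_{\max}\le(1+D(\ell))\sqrt{M_1\cdots M_d}.$$ (b) If $\ell<\frac14$ and $\vec\epsilon$ has rank one, then the extreme singular values of $\boldsymbol{F}(\Omega',U)$ satisfy $$\sigma_{\min}\ge(1-C(\ell))^d\sqrt{M_1\cdots M_d}\quad\text{and}\quad\sigma_{\max}\le(1+C(\ell))^d\sqrt{M_1\cdots M_d}.$$ (c) If $\vec\epsilon$ has rank one, then $\boldsymbol{F}(\Omega',U)$ is nonsingular if and only if for every $\vec i,\vec j\in\Omega$, with $i_k\ne j_k$ for every $k=1,\dots,d$, we have that $$\frac1{M_k}\big(j_k-i_k+\epsilon_k(j_k)-\epsilon_k(i_k)\big)\notin\mathbb{Z}.$$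
   Context: $\mathbb{N}$ denotes the natural numbers (positive integers). $R(\vec M)=[0,M_1)\times\cdots\times[0,M_d)$. $\vec M^{-1}\Omega=\{(\omega_1/M_1,\dots,\omega_d/M_d):\vec\omega\in\Omega\}\subset[0,1)^d$. $\|\vec\epsilon\|_\infty=\max_{\vec j\in\Omega}\max_{1\le k\le d}|(\vec\epsilon(\vec j))_k|$. A nontrivial $\vec\epsilon$ is (at most) rank one if there exist real-valued functions $\epsilon_1,\dots,\epsilon_d$ of one integer variable such that $\vec\epsilon(\vec j)=(\epsilon_1(j_1),\dots,\epsilon_d(j_d))$ for each $\vec j$. $\sigma_{\min},\sigma_{\max}$ are the smallest and largest singular values, where an $m\times n$ matrix has $n$ singular values $\sigma_1\ge\cdots\ge\sigma_n\ge0$ (here $n=|U|\le m=|\Omega|$). The functions $C,D$ are $$C(t)=1-\cos(\pi t)+\sin(\pi t),\qquad D(t)=\Big(1-\cos(\pi t)+\sin(\pi t)+\frac{\sin(\pi t)}{\pi t}\Big)^d-\Big(\frac{\sin(\pi t)}{\pi t}\Big)^d,$$ with $\frac{\sin(\pi t)}{\pi t}$ read as $1$ at $t=0$.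
   Formalization: In (c) the equivalence is proved for U = M^{-1}Ω only (it fails for proper U, e.g. M=2, U={0}, ε(0)=0, ε(1)=-1); for other nonempty U the condition is shown to give σ_min>0. The condition is read for each k separately: i_k≠j_k implies the k-th quotient is not an integer. *)

theory Defs
  imports
    "HOL-Analysis.Analysis"
    "Jordan_Normal_Form.Schur_Decomposition"
begin

(* The library for matrices of variable size uses the same symbols for its own vectors;
   here "$" and the inner product always refer to the Euclidean space real ^ 'd. *)
no_notation Matrix.vec_index (infixl "$" 100)
no_notation Matrix.scalar_prod (infix "\<bullet>" 70)

definition R_box :: "nat ^ 'd \<Rightarrow> (real ^ 'd) set" where
  "R_box M = {x. \<forall>k. 0 \<le> x $ k \<and> x $ k < real (M $ k)}"

definition of_int_vec :: "int ^ 'd \<Rightarrow> real ^ 'd" where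
  "of_int_vec j = (\<chi> k. real_of_int (j $ k))"

definition Omega :: "nat ^ 'd \<Rightarrow> (int ^ 'd) set" where
  "Omega M = {j. of_int_vec j \<in> R_box M}"

definition scaled_Omega :: "nat ^ 'd \<Rightarrow> (real ^ 'd) set" where
  "scaled_Omega M = (\<lambda>j. \<chi> k. real_of_int (j $ k) / real (M $ k)) ` Omega M"

definition sup_norm :: "nat ^ 'd \<Rightarrow> (int ^ 'd \<Rightarrow> real ^ 'd) \<Rightarrow> real" where
  "sup_norm M \<epsilon> = Max {\<bar>\<epsilon> j $ k\<bar> | j k. j \<in> Omega M}"

definition rank_one_with ::
    "nat ^ 'd \<Rightarrow> (int ^ 'd \<Rightarrow> real ^ 'd) \<Rightarrow> ('d \<Rightarrow> int \<Rightarrow> real) \<Rightarrow> bool" where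
  "rank_one_with M \<epsilon> e \<longleftrightarrow> (\<forall>j \<in> Omega M. \<epsilon> j = (\<chi> k. e k (j $ k)))"

(* "At most rank one": the zero perturbation is included. *)
definition rank_one :: "nat ^ 'd \<Rightarrow> (int ^ 'd \<Rightarrow> real ^ 'd) \<Rightarrow> bool" where
  "rank_one M \<epsilon> \<longleftrightarrow> (\<exists>e. rank_one_with M \<epsilon> e)"

(* Matrices are indexed by initial segments of the naturals, so the index sets of rows and
   columns enter through duplicate-free lists js and us that enumerate them. Rows are indexed
   by j itself (not by the point j + \<epsilon> j), so coinciding perturbed points give repeated rows. *)
definition fourier_mat ::
    "(int ^ 'd \<Rightarrow> real ^ 'd) \<Rightarrow> (int ^ 'd) list \<Rightarrow> (real ^ 'd) list \<Rightarrow> complex mat" where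
  "fourier_mat \<epsilon> js us = mat (length js) (length us)
     (\<lambda>(r, c). exp (2 * of_real pi * \<i> *
        of_real ((of_int_vec (js ! r) + \<epsilon> (js ! r)) \<bullet> (us ! c))))"

(* The set of singular values of an m x n matrix with n <= m, namely the nonnegative square
   roots of the eigenvalues of the n x n matrix A^* A; multiplicities are irrelevant for the
   extreme ones. *)
definition singular_values :: "complex mat \<Rightarrow> real set" where
  "singular_values A = {s. 0 \<le> s \<and> eigenvalue (mat_adjoint A * A) (of_real (s\<^sup>2))}"

definition sigma_min :: "complex mat \<Rightarrow> real" where
  "sigma_min A = Min (singular_values A)"

definition sigma_max :: "complex mat \<Rightarrow> real" where
  "sigma_max A = Max (singular_values A)"

definition C_fun :: "real \<Rightarrow> real" where
  "C_fun t = 1 - cos (pi * t) + sin (pi * t)"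

definition sinc_pi :: "real \<Rightarrow> real" where
  "sinc_pi t = (if t = 0 then 1 else sin (pi * t) / (pi * t))"

definition D_fun :: "nat \<Rightarrow> real \<Rightarrow> real" where
  "D_fun d t = (1 - cos (pi * t) + sin (pi * t) + sinc_pi t) ^ d - sinc_pi t ^ d"

end

theory Submission
  imports Defs
begin

text \<open>
  The columns of the Fourier matrix are indexed by grid points \<open>m / M\<close>, so it is enough to study the
  kernel \<open>sampling M \<theta>\<close> on \<open>\<Omega> \<times> \<Omega>\<close>, where \<open>\<theta>\<close> is the perturbation; a smaller \<open>U\<close> only means that the
  coefficient function vanishes at some \<open>m\<close>. Without perturbation the columns are orthogonal of squared
  length \<open>M_1 \<cdots> M_d\<close>, which gives all singular values. In general, the extreme singular
  values occur as quotients \<open>\<parallel>A v\<parallel> / \<parallel>v\<parallel>\<close> (\<open>sigma_bounds\<close>), so everything reduces to norm estimates.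

  The estimates follow Kadec. In one dimension an entry changes by the factor \<open>exp (2 \<pi> i t n / M)\<close>, and
  after removing the unimodular row factor \<open>exp (\<pi> i t)\<close> there remains \<open>exp (- i t x)\<close> with \<open>x\<close> in
  \<open>[-\<pi>, \<pi>]\<close>. Kadec expands its real part in cosines of integer frequency and its imaginary part in sines
  of half-integer frequency, with coefficients that depend on the row and functions, bounded by one, that
  depend on the column. Shifted by \<open>\<pi>\<close>, all these functions become cosines. Because only the grid
  values of \<open>x\<close> matter, infinite Fourier series can be replaced by a finite cosine sum on a grid
  (\<open>kadec_expansion\<close>), whose coefficients have a closed form. For \<open>\<bar>t\<bar> \<le> l \<le> 1/4\<close> and nonzero
  frequency their moduli are largest at \<open>t = l\<close> (\<open>coeff_bounds\<close>), and at the end point of the grid, where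
  all cosines are \<open>1\<close>, the sum of these moduli can be read off (\<open>sum_kadec_bound\<close>). The total, including the
  loss in the coefficient of frequency zero, is \<open>C l\<close>.

  For part (b) the coordinates are perturbed one after another (\<open>perturb_one_coordinate\<close>). As long as
  coordinate \<open>k\<close> is unperturbed and the others are separable, columns that differ in coordinate \<open>k\<close>
  are orthogonal, so a multiplier in \<open>m_k\<close> of modulus at most one does not increase norms, and each step
  costs a factor \<open>1 \<plusminus> C l\<close>. For part (a) the product of the \<open>d\<close> expansions is compared with the
  unperturbed matrix at once (\<open>sampling_bounds\<close>). The product of the zero-frequency coefficients is
  treated separately, which produces \<open>D l\<close> with the average of \<open>cos (l x)\<close> over the grid in place of the
  integral average \<open>sin (\<pi> l) / (\<pi> l)\<close>; the former is not larger, and \<open>D\<close> increases in this quantity.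

  For part (c) the kernel is a product of one-dimensional Vandermonde matrices. If the nodes are distinct
  in each coordinate, the product of the left inverses is a left inverse of the kernel
  (\<open>separable_sampling_injective\<close>); if two nodes agree in some coordinate, the matrix has two equal rows.
\<close>


section \<open>Finite cosine expansions of sine and cosine\<close>

lemma sum_cis_roots_of_unity:
  fixes L :: nat and n :: int
  assumes "L > 0"
  shows "(\<Sum>p<L. cis (2 * pi * real p * real_of_int n / real L))
           = (if int L dvd n then of_nat L else 0)"
proof -
  define z where "z = cis (2 * pi * real_of_int n / real L)"
  have pow: "cis (2 * pi * real p * real_of_int n / real L) = z ^ p" for p
  proof -
    have "z ^ p = cis (real p * (2 * pi * real_of_int n / real L))" by (simp only: z_def Complex.DeMoivre)
    then show ?thesis by (simp add: mult_ac)
  qed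
  have zL: "z ^ L = 1"
  proof -
    have "z ^ L = cis (real L * (2 * pi * real_of_int n / real L))" by (simp only: z_def Complex.DeMoivre)
    then show ?thesis using assms by (simp add: cis_multiple_2pi)
  qed
  show ?thesis
  proof (cases "int L dvd n")
    case True
    then obtain r where "n = int L * r" by auto
    then have "2 * pi * real_of_int n / real L = 2 * pi * real_of_int r" using assms by simp
    then have "z = 1" by (simp only: z_def cis_multiple_2pi Ints_of_int)
    then show ?thesis using True pow by simp
  next
    case False
    have "z \<noteq> 1"
    proof
      assume "z = 1"
      then have "cos (2 * pi * real_of_int n / real L) = 1" 
        unfolding z_def by (metis cis.sel(1) one_complex.sel(1))
      then obtain r :: int where "2 * pi * real_of_int n / real L = of_int r * 2 * pi"
        by (auto simp: cos_one_2pi_int)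
      then have "real_of_int n = real_of_int r * real L" using assms by (simp add: field_simps)
      then have "n = r * int L" by (metis of_int_eq_iff of_int_mult of_int_of_nat_eq)
      then show False using False by simp
    qed
    then have "(\<Sum>p<L. z ^ p) = 0" using zL by (simp add: geometric_sum)
    then show ?thesis using False pow by simp
  qed
qed

text \<open>On the points \<open>0, ..., L\<close>, all cosines whose frequencies have one parity add up to a point mass at \<open>0\<close>
  and a signed point mass at \<open>L\<close>. This is the source term of the difference equation below.\<close>

lemma sum_cos_fixed_parity:
  fixes L n r :: nat
  assumes "L > 0" "n \<le> L"
  shows "(\<Sum>p<L. cos (pi * real (2 * p + r) * real n / real L))
           = (if n = 0 then real L else if n = L then (- 1) ^ r * real L else 0)"
proof -
  have "(\<Sum>p<L. cis (pi * real (2 * p + r) * real n / real L))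
      = (\<Sum>p<L. cis (2 * pi * real p * real_of_int (int n) / real L)) * cis (pi * real r * real n / real L)"
    unfolding sum_distrib_right cis_mult by (intro sum.cong refl arg_cong[of _ _ cis]) (use assms in \<open>simp add: field_simps\<close>)
  also have "\<dots> = (if int L dvd int n then of_nat L else 0) * cis (pi * real r * real n / real L)"
    by (subst sum_cis_roots_of_unity) (use assms in auto)
  finally have eq: "Re (\<Sum>p<L. cis (pi * real (2 * p + r) * real n / real L))
      = Re ((if int L dvd int n then of_nat L else 0) * cis (pi * real r * real n / real L))" by simp
  have dvd: "L dvd n \<longleftrightarrow> n = 0 \<or> n = L" using assms
    by (metis dvd_0_right dvd_imp_le dvd_refl le_antisym neq0_conv)
  show ?thesis using eq assms by (auto simp: dvd cos_pi_eq_zero mult.commute)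
qed

text \<open>A second order recurrence has a two-dimensional solution space, here spanned by \<open>cos (n \<theta>)\<close> and
  \<open>sin (n \<theta>)\<close>. The condition on \<open>S 1\<close> is what the even continuation \<open>S (- 1) = S 1\<close> and a
  point source at \<open>0\<close> give for the recurrence at \<open>n = 0\<close>.\<close>

lemma cosine_recurrence:
  fixes S :: "nat \<Rightarrow> real"
  assumes "\<And>n. 0 < n \<Longrightarrow> n < L \<Longrightarrow> S (Suc n) + S (n - 1) = 2 * cos \<theta> * S n"
      and "S 1 = cos \<theta> * S 0 - R * sin \<theta>" "n \<le> L"
  shows "S n = S 0 * cos (real n * \<theta>) - R * sin (real n * \<theta>)"
  using assms(3)
proof (induction n rule: less_induct)
  case (less n)
  consider "n = 0" | "n = 1" | m where "n = Suc (Suc m)" 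
    by (metis One_nat_def not0_implies_Suc)
  then show ?case
  proof cases
    case 3
    have "S (Suc (Suc m)) = 2 * cos \<theta> * S (Suc m) - S m"
      using assms(1)[of "Suc m"] less.prems 3 by simp
    also have "\<dots> = 2 * cos \<theta> * (S 0 * cos (real (Suc m) * \<theta>) - R * sin (real (Suc m) * \<theta>))
         - (S 0 * cos (real m * \<theta>) - R * sin (real m * \<theta>))"
      using less.IH[of m] less.IH[of "Suc m"] less.prems 3 by simp
    also have "\<dots> = S 0 * (2 * cos \<theta> * cos (real (Suc m) * \<theta>) - cos (real m * \<theta>))
                - R * (2 * cos \<theta> * sin (real (Suc m) * \<theta>) - sin (real m * \<theta>))"
      by (simp add: algebra_simps)
    also have "2 * cos \<theta> * cos (real (Suc m) * \<theta>) - cos (real m * \<theta>) = cos (real n * \<theta>)"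
      using cos_add[of "real (Suc m) * \<theta>" \<theta>] cos_diff[of "real (Suc m) * \<theta>" \<theta>] 3
      by (simp add: algebra_simps)
    also have "2 * cos \<theta> * sin (real (Suc m) * \<theta>) - sin (real m * \<theta>) = sin (real n * \<theta>)"
      using sin_add[of "real (Suc m) * \<theta>" \<theta>] sin_diff[of "real (Suc m) * \<theta>" \<theta>] 3
      by (simp add: algebra_simps)
    finally show ?thesis using 3 by simp
  qed (use assms(2) in \<open>simp_all add: mult.commute\<close>)
qed

text \<open>Each cosine is an eigenvector of the second difference operator with eigenvalue determined by its
  frequency. Dividing by the distance of the eigenvalues from that of \<open>\<theta>\<close> therefore inverts the shifted
  operator on the sum of all these cosines, that is, on point masses at the ends: \<open>S\<close> solves the homogeneous
  recurrence in between and is a combination of \<open>cos (n \<theta>)\<close> and \<open>sin (n \<theta>)\<close>. The relation between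
  \<open>S L\<close> and \<open>S 0\<close> then determines \<open>S 0\<close>.\<close>

lemma resolvent_cosine_sum:
  fixes L r :: nat and R \<theta> :: real
  assumes L: "L > 1" and r: "r \<le> 1" 
    and ne: "\<And>p. p < L \<Longrightarrow> cos \<theta> \<noteq> cos (pi * real (2 * p + r) / real L)"
  defines "S \<equiv> \<lambda>n::nat. \<Sum>p<L. R * sin \<theta> / (real L * (cos \<theta> - cos (pi * real (2 * p + r) / real L)))
                          * cos (pi * real (2 * p + r) * real n / real L)"
  shows "n \<le> L \<Longrightarrow> S n = S 0 * cos (real n * \<theta>) - R * sin (real n * \<theta>)"
    and "S L = (- 1) ^ r * S 0"
proof -
  define c where "c = (\<lambda>p. R * sin \<theta> / (real L * (cos \<theta> - cos (pi * real (2 * p + r) / real L))))"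
  define x where "x = (\<lambda>p. pi * real (2 * p + r) / real L)"
  have S: "S n = (\<Sum>p<L. c p * cos (real n * x p))" for n
    unfolding S_def c_def x_def by (intro sum.cong refl) (simp add: field_simps)
  have c: "c p * (cos \<theta> - cos (x p)) = R * sin \<theta> / real L" if "p < L" for p
    using ne[OF that] L unfolding c_def x_def by (simp add: field_simps)
  have tot: "(\<Sum>p<L. cos (real n * x p)) = (if n = 0 then real L else if n = L then (- 1) ^ r * real L else 0)"
    if "n \<le> L" for n
    using sum_cos_fixed_parity[of L n r] L that unfolding x_def by (simp add: field_simps)
  have lap: "2 * cos \<theta> * S n - (\<Sum>p<L. c p * (2 * cos (x p) * cos (real n * x p)))
       = 2 * (R * sin \<theta> / real L) * (\<Sum>p<L. cos (real n * x p))" for n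
  proof -
    have "2 * cos \<theta> * S n - (\<Sum>p<L. c p * (2 * cos (x p) * cos (real n * x p)))
       = (\<Sum>p<L. 2 * (c p * (cos \<theta> - cos (x p))) * cos (real n * x p))"
      unfolding S sum_distrib_left sum_subtractf[symmetric]
      by (intro sum.cong refl) (simp add: algebra_simps)
    also have "\<dots> = (\<Sum>p<L. 2 * (R * sin \<theta> / real L) * cos (real n * x p))"
      using c by (intro sum.cong refl) simp
    finally show ?thesis by (simp add: sum_distrib_left)
  qed
  have rec: "S (Suc n) + S (n - 1) = 2 * cos \<theta> * S n" if "0 < n" "n < L" for n
  proof -
    have "c p * cos (real (Suc n) * x p) + c p * cos (real (n - 1) * x p)
         = c p * (2 * cos (x p) * cos (real n * x p))" for p
    proof -
      have "real (Suc n) * x p = real n * x p + x p" "real (n - 1) * x p = real n * x p - x p"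
        using that(1) by (simp_all add: algebra_simps of_nat_diff)
      then show ?thesis by (simp only: cos_add cos_diff) (simp add: algebra_simps)
    qed
    then have "S (Suc n) + S (n - 1) = (\<Sum>p<L. c p * (2 * cos (x p) * cos (real n * x p)))"
      unfolding S sum.distrib[symmetric] by (intro sum.cong refl)
    with lap[of n] tot[of n] that show ?thesis by simp
  qed
  have "S 1 = cos \<theta> * S 0 - R * sin \<theta>"
  proof -
    have "2 * cos \<theta> * S 0 - 2 * S 1 = 2 * (R * sin \<theta> / real L) * real L"
      using lap[of 0] tot[of 0] unfolding S[of 1] by (simp add: sum_distrib_left algebra_simps)
    then show ?thesis using L by (simp add: field_simps)
  qed
  then show "n \<le> L \<Longrightarrow> S n = S 0 * cos (real n * \<theta>) - R * sin (real n * \<theta>)"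
    using cosine_recurrence[of L S \<theta> R n] rec by blast
  have "cos (real L * x p) = (- 1) ^ r" for p
  proof -
    have "real L * x p = pi * real (2 * p + r)" using L by (simp add: x_def)
    then show ?thesis using cos_npi2[of "2 * p + r"] by (simp add: power_add power_mult)
  qed
  then show "S L = (- 1) ^ r * S 0" unfolding S by (simp add: sum_distrib_right[symmetric] mult.commute)
qed

text \<open>These are the finite counterparts of Kadec's Fourier coefficients of \<open>sin (t x)\<close> and, with reversed
  sign, of \<open>cos (t x)\<close>. The reversal makes both families nonnegative for \<open>0 \<le> t \<le> 1/4\<close> and \<open>q > 0\<close>.
  The index \<open>q\<close> stands for the frequency \<open>q / 2\<close>. The coefficient of frequency zero is defined as an average
  so that \<open>t = 0\<close> needs no separate treatment.\<close>

definition odd_coeff :: "nat \<Rightarrow> nat \<Rightarrow> real \<Rightarrow> real" where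
  "odd_coeff L q t = cos (pi * t) * sin (2 * pi * t / real L)
      / (real L * (cos (2 * pi * t / real L) - cos (pi * real q / real L)))"

definition even_coeff :: "nat \<Rightarrow> nat \<Rightarrow> real \<Rightarrow> real" where
  "even_coeff L q t = sin (pi * t) * sin (2 * pi * t / real L)
      / (real L * (cos (2 * pi * t / real L) - cos (pi * real q / real L)))"

definition mean_coeff :: "nat \<Rightarrow> real \<Rightarrow> real" where
  "mean_coeff L t = (\<Sum>n<L. cos (t * (pi - 2 * pi * real n / real L))) / real L"

text \<open>The denominators of the coefficients are positive: every frequency angle \<open>\<pi> q / L\<close> has distance at
  least \<open>\<pi> / L\<close> from the multiples of \<open>2 \<pi>\<close>, while \<open>\<bar>2 \<pi> t / L\<bar> < \<pi> / L\<close>.\<close>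

lemma cos_frequency_gap:
  assumes "L > 1" "0 < q" "q < 2 * L" "\<bar>t\<bar> < 1 / 2"
  shows "cos (pi * real q / real L) < cos (2 * pi * t / real L)"
proof -
  have 1: "cos (2 * pi * t / real L) > cos (pi / real L)"
  proof -
    have "cos (2 * pi * t / real L) = cos (2 * pi * \<bar>t\<bar> / real L)"
      by (cases "t \<ge> 0") auto
    also have "\<dots> > cos (pi / real L)"
    proof (rule cos_monotone_0_pi)
      show "2 * pi * \<bar>t\<bar> / real L < pi / real L" using assms by (simp add: divide_simps)
      show "pi / real L \<le> pi" using assms by (simp add: divide_simps)
    qed simp
    finally show ?thesis .
  qed
  have "cos (pi * real q / real L) \<le> cos (pi / real L)"
  proof (cases "q \<le> L")
    case True
    show ?thesis by (rule cos_monotone_0_pi_le) (use True assms in \<open>simp_all add: divide_simps\<close>)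
  next
    case False
    have "cos (pi * real q / real L) = cos (pi * real (2 * L - q) / real L)"
    proof -
      have "pi * real (2 * L - q) / real L = 2 * pi - pi * real q / real L"
        using assms by (simp add: of_nat_diff field_simps)
      then show ?thesis by (simp add: cos_diff)
    qed
    also have "\<dots> \<le> cos (pi / real L)" 
      by (rule cos_monotone_0_pi_le) (use False assms in \<open>simp_all add: divide_simps of_nat_diff\<close>)
    finally show ?thesis .
  qed
  with 1 show ?thesis by simp
qed

text \<open>With \<open>x = \<pi> - 2 \<pi> n / L\<close> this is the expansion of \<open>sin (t x)\<close> in sines of half-integer frequency,
  which are cosines with respect to \<open>n\<close>.\<close>

lemma odd_cosine_expansion:
  assumes L: "L > 1" and t: "\<bar>t\<bar> < 1 / 2" and n: "n \<le> L"
  shows "(\<Sum>p<L. odd_coeff L (2 * p + 1) t * cos (pi * real (2 * p + 1) * real n / real L))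
           = sin (t * (pi - 2 * pi * real n / real L))"
proof -
  define \<theta> where "\<theta> = 2 * pi * t / real L"
  define S where "S = (\<lambda>n::nat. \<Sum>p<L. cos (pi * t) * sin \<theta> / (real L * (cos \<theta> - cos (pi * real (2 * p + 1) / real L)))
                          * cos (pi * real (2 * p + 1) * real n / real L))"
  have ne: "cos \<theta> \<noteq> cos (pi * real (2 * p + 1) / real L)" if "p < L" for p
    using cos_frequency_gap[of L "2 * p + 1" t] that L t unfolding \<theta>_def by auto
  have "pi * \<bar>t\<bar> < pi * (1 / 2)" using t by (intro mult_strict_left_mono) auto
  then have "\<bar>pi * t\<bar> < pi / 2" by (simp add: abs_mult)
  then have cp: "cos (pi * t) > 0" by (intro cos_gt_zero_pi) linarith+
  \<comment> \<open>Comparing both expressions for \<open>S L\<close> leaves only one possible value of \<open>S 0\<close>.\<close>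
  have SL: "S L = - S 0" using resolvent_cosine_sum(2)[where r = 1 and R = "cos (pi * t)", OF L _ ne] by (simp add: S_def)
  have Sn: "S n = S 0 * cos (real n * \<theta>) - cos (pi * t) * sin (real n * \<theta>)" if "n \<le> L" for n
    using resolvent_cosine_sum(1)[where r = 1 and R = "cos (pi * t)" and n = n, OF L _ ne] that by (simp add: S_def)
  have "real L * \<theta> = 2 * (pi * t)" using L by (simp add: \<theta>_def)
  with Sn[of L] SL have "- S 0 = S 0 * cos (2 * (pi * t)) - cos (pi * t) * sin (2 * (pi * t))" by simp
  then have "2 * (cos (pi * t))\<^sup>2 * S 0 = 2 * (cos (pi * t))\<^sup>2 * sin (pi * t)"
    unfolding cos_double_cos sin_double by (auto simp: algebra_simps power2_eq_square)
  then have "S 0 = sin (pi * t)" using cp by auto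
  with Sn[OF n] have "S n = sin (pi * t - real n * \<theta>)" by (simp add: sin_diff)
  also have "pi * t - real n * \<theta> = t * (pi - 2 * pi * real n / real L)" by (simp add: \<theta>_def algebra_simps)
  finally show ?thesis by (simp add: S_def odd_coeff_def \<theta>_def)
qed

lemma even_cosine_expansion_nonzero:
  assumes L: "L > 1" and t: "\<bar>t\<bar> < 1 / 2" "t \<noteq> 0" and n: "n \<le> L"
  shows "(\<Sum>p<L. - even_coeff L (2 * p) t * cos (pi * real (2 * p) * real n / real L))
           = cos (t * (pi - 2 * pi * real n / real L))"
proof -
  define \<theta> where "\<theta> = 2 * pi * t / real L"
  define S where "S = (\<lambda>n::nat. \<Sum>p<L. - sin (pi * t) * sin \<theta> / (real L * (cos \<theta> - cos (pi * real (2 * p + 0) / real L)))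
                          * cos (pi * real (2 * p + 0) * real n / real L))"
  have "pi * \<bar>t\<bar> < pi * (1 / 2)" using t by (intro mult_strict_left_mono) auto
  then have ab: "\<bar>pi * t\<bar> < pi / 2" "pi * t \<noteq> 0" using t by (simp_all add: abs_mult)
  have "sin \<bar>pi * t\<bar> > 0" by (rule sin_gt_zero) (use ab in linarith)+
  then have sp: "sin (pi * t) \<noteq> 0" by (auto simp: abs_if split: if_splits)
  have "cos \<theta> \<noteq> 1"
  proof -
    have "cos \<bar>\<theta>\<bar> < cos 0"
    proof (rule cos_monotone_0_pi)
      show "0 < \<bar>\<theta>\<bar>" using t L by (simp add: \<theta>_def)
      have "\<bar>\<theta>\<bar> = 2 * (pi * \<bar>t\<bar>) / real L" by (simp add: \<theta>_def abs_mult)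
      also have "\<dots> \<le> pi"
      proof -
        have "pi * \<bar>t\<bar> \<le> pi * (1 / 2)" using t by (intro mult_left_mono) auto
        moreover have "pi * 1 \<le> pi * real L" using L by (intro mult_left_mono) auto
        ultimately show ?thesis using L by (simp add: divide_simps)
      qed
      finally show "\<bar>\<theta>\<bar> \<le> pi" .
    qed simp
    then show ?thesis by simp
  qed
  then have ne: "cos \<theta> \<noteq> cos (pi * real (2 * p + 0) / real L)" if "p < L" for p
    using cos_frequency_gap[of L "2 * p" t] that L t unfolding \<theta>_def by (cases "p = 0") auto
  have SL: "S L = S 0" using resolvent_cosine_sum(2)[where r = 0 and R = "- sin (pi * t)", OF L _ ne] by (simp add: S_def)
  have Sn: "S n = S 0 * cos (real n * \<theta>) + sin (pi * t) * sin (real n * \<theta>)" if "n \<le> L" for n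
    using resolvent_cosine_sum(1)[where r = 0 and R = "- sin (pi * t)" and n = n, OF L _ ne] that by (simp add: S_def)
  have "real L * \<theta> = 2 * (pi * t)" using L by (simp add: \<theta>_def)
  with Sn[of L] SL have "S 0 = S 0 * cos (2 * (pi * t)) + sin (pi * t) * sin (2 * (pi * t))" by simp
  then have "2 * (sin (pi * t))\<^sup>2 * S 0 = 2 * (sin (pi * t))\<^sup>2 * cos (pi * t)"
    unfolding cos_double_sin sin_double by (auto simp: algebra_simps power2_eq_square)
  then have "S 0 = cos (pi * t)" using sp by auto
  with Sn[OF n] have "S n = cos (pi * t - real n * \<theta>)" by (simp add: cos_diff)
  also have "pi * t - real n * \<theta> = t * (pi - 2 * pi * real n / real L)" by (simp add: \<theta>_def algebra_simps)
  finally show ?thesis by (simp add: S_def even_coeff_def \<theta>_def)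
qed

text \<open>Averaging the cosine expansion over \<open>n\<close> kills every term of nonzero frequency.\<close>

lemma mean_coeff_closed_form:
  assumes L: "L > 1" and t: "\<bar>t\<bar> < 1 / 2" "t \<noteq> 0"
  shows "mean_coeff L t = - even_coeff L 0 t"
proof -
  have "real L * mean_coeff L t
     = (\<Sum>n<L. \<Sum>p<L. - even_coeff L (2 * p) t * cos (pi * real (2 * p) * real n / real L))"
  proof -
    have "real L * mean_coeff L t = (\<Sum>n<L. cos (t * (pi - 2 * pi * real n / real L)))"
      using L by (simp add: mean_coeff_def)
    also have "\<dots> = (\<Sum>n<L. \<Sum>p<L. - even_coeff L (2 * p) t * cos (pi * real (2 * p) * real n / real L))"
      by (intro sum.cong refl even_cosine_expansion_nonzero[symmetric]) (use L t in auto)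
    finally show ?thesis .
  qed
  also have "\<dots> = (\<Sum>p<L. - even_coeff L (2 * p) t * (\<Sum>n<L. cos (pi * real (2 * p) * real n / real L)))"
    unfolding sum_distrib_left by (rule sum.swap)
  also have "\<dots> = (\<Sum>p<L. if p = 0 then - even_coeff L 0 t * real L else 0)"
  proof (intro sum.cong refl)
    fix p assume "p \<in> {..<L}"
    then have "(\<Sum>n<L. cos (pi * real (2 * p) * real n / real L)) = (if p = 0 then real L else 0)"
      using sum_cos_fixed_parity[of L p 0] L by (simp add: mult_ac)
    then show "- even_coeff L (2 * p) t * (\<Sum>n<L. cos (pi * real (2 * p) * real n / real L))
       = (if p = 0 then - even_coeff L 0 t * real L else 0)" by simp
  qed
  also have "\<dots> = - even_coeff L 0 t * real L" using L by (simp add: sum.delta)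
  finally have "real L * mean_coeff L t = real L * - even_coeff L 0 t" by simp
  then show ?thesis using L unfolding mult_cancel_left by simp
qed

lemma even_cosine_expansion:
  assumes L: "L > 1" and t: "\<bar>t\<bar> < 1 / 2" and n: "n \<le> L"
  shows "mean_coeff L t - (\<Sum>p=1..<L. even_coeff L (2 * p) t * cos (pi * real (2 * p) * real n / real L))
           = cos (t * (pi - 2 * pi * real n / real L))"
proof (cases "t = 0")
  case True
  then show ?thesis using L by (simp add: mean_coeff_def even_coeff_def)
next
  case False
  have "{..<L} = insert 0 {1..<L}" using L by auto
  then have "(\<Sum>p<L. - even_coeff L (2 * p) t * cos (pi * real (2 * p) * real n / real L))
     = - even_coeff L 0 t - (\<Sum>p=1..<L. even_coeff L (2 * p) t * cos (pi * real (2 * p) * real n / real L))"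
    by (simp add: sum_negf)
  then show ?thesis
    using even_cosine_expansion_nonzero[OF L t False n] mean_coeff_closed_form[OF L t False] by simp
qed

text \<open>The restriction to \<open>t \<le> 1/4\<close> comes from here, since \<open>sin (\<pi> t) \<le> cos (\<pi> t)\<close> holds exactly up to that point.
  With this and \<open>sin (h t) \<le> h t\<close>, positivity of the derivative follows from \<open>\<pi> t \<le> cos (h t)\<close>, which
  holds on \<open>[0, 1/4]\<close> because \<open>h\<close> is small.\<close>

lemma cos_pi_mult_sin_mono:
  assumes "0 \<le> s" "s \<le> t" "t \<le> 1 / 4" "0 \<le> h" "h \<le> pi / 2"
  shows "cos (pi * s) * sin (h * s) \<le> cos (pi * t) * sin (h * t)"
proof (rule DERIV_nonneg_imp_nondecreasing[OF assms(2)])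
  fix x assume x: "s \<le> x" "x \<le> t"
  have x': "0 \<le> x" "x \<le> 1 / 4" using x assms by auto
  have hx: "0 \<le> h * x" "h * x \<le> pi / 8" 
    using x' assms mult_mono[of h "pi / 2" x "1 / 4"] by auto
  have px: "0 \<le> pi * x" "pi * x \<le> pi / 4" using x' by auto
  \<comment> \<open>Since \<open>h x \<le> \<pi>/8\<close>, the rough bounds \<open>\<pi> x \<le> 0.8 \<le> cos (\<pi>/6)\<close> suffice.\<close>
  have "pi \<le> 3.2" using pi_less_4 pi_approx by simp
  then have "pi * x \<le> 0.8" using px by linarith
  also have "0.8 \<le> cos (pi / 6)" 
  proof -
    have "(1.6::real) \<le> sqrt 3" by (rule real_le_rsqrt) (simp add: power2_eq_square)
    then show ?thesis by (simp add: cos_30)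
  qed
  also have "cos (pi / 6) \<le> cos (h * x)" by (rule cos_monotone_0_pi_le) (use hx in auto)
  finally have A: "pi * x \<le> cos (h * x)" .
  have B: "0 \<le> sin (pi * x)" using px by (intro sin_ge_zero) auto
  have C: "sin (pi * x) \<le> cos (pi * x)"
  proof -
    have "sin (pi * x) \<le> sin (pi / 2 - pi * x)" by (rule sin_monotone_2pi_le) (use px pi_gt_zero in linarith)+
    then show ?thesis by (simp add: sin_diff)
  qed
  have "sin (pi * x) * pi * sin (h * x) \<le> sin (pi * x) * pi * (h * x)"
    using B hx by (intro mult_left_mono sin_x_le_x) auto
  also have "\<dots> = h * (sin (pi * x) * (pi * x))" by simp
  also have "\<dots> \<le> h * (cos (pi * x) * cos (h * x))"
    using A B C px assms by (intro mult_left_mono mult_mono) auto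
  finally show "\<exists>y. ((\<lambda>a. cos (pi * a) * sin (h * a)) has_real_derivative y) (at x) \<and> 0 \<le> y"
    by (intro exI[of _ "cos (pi * x) * (cos (h * x) * h) + - sin (pi * x) * pi * sin (h * x)"] conjI)
       (auto intro!: derivative_eq_intros simp: algebra_simps)
qed

text \<open>The coefficients are quotients whose numerators increase and whose positive denominators decrease
  with \<open>\<bar>t\<bar>\<close>. Hence a single bound serves all rows of a perturbed matrix.\<close>

lemma coeff_bounds:
  assumes L: "L > 3" and q: "0 < q" "q < 2 * L" and t: "\<bar>t\<bar> \<le> l" "l \<le> 1 / 4"
  shows "\<bar>odd_coeff L q t\<bar> \<le> odd_coeff L q l" "\<bar>even_coeff L q t\<bar> \<le> even_coeff L q l"
proof -
  define h where "h = 2 * pi / real L"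
  have h: "0 \<le> h" "h \<le> pi / 2" using L by (simp_all add: h_def divide_simps)
  define D where "D = (\<lambda>t. real L * (cos (h * t) - cos (pi * real q / real L)))"
  have l: "0 \<le> l" using t by simp
  have hl: "h * l \<le> pi / 8" "0 \<le> h * l" using h l t mult_mono[of h "pi / 2" l "1 / 4"] by auto
  have ht: "h * \<bar>t\<bar> \<le> h * l" using h t by (intro mult_left_mono) auto
  have Dl: "0 < D l" using cos_frequency_gap[of L q l] L q t l unfolding D_def h_def by simp
  have "cos (h * l) \<le> cos (h * \<bar>t\<bar>)" by (rule cos_monotone_0_pi_le) (use hl ht h in auto)
  also have "cos (h * \<bar>t\<bar>) = cos (h * t)" by (cases "t \<ge> 0") auto
  finally have Dt: "D l \<le> D t" unfolding D_def using L by (intro mult_left_mono) auto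
  have s: "sin (h * l) \<ge> 0" "\<bar>sin (h * t)\<bar> \<le> sin (h * l)" "\<bar>sin (h * t)\<bar> = sin (h * \<bar>t\<bar>)"
  proof -
    show "sin (h * l) \<ge> 0" using hl by (intro sin_ge_zero) auto
    have "sin (h * \<bar>t\<bar>) \<ge> 0" using hl ht h by (intro sin_ge_zero) auto
    then show "\<bar>sin (h * t)\<bar> = sin (h * \<bar>t\<bar>)" by (cases "t \<ge> 0") auto
    moreover have "- (pi / 2) \<le> h * \<bar>t\<bar>" using h mult_nonneg_nonneg[of h "\<bar>t\<bar>"] pi_gt_zero by linarith
    then have "sin (h * \<bar>t\<bar>) \<le> sin (h * l)" by (intro sin_monotone_2pi_le) (use hl ht pi_gt_zero in linarith)+
    ultimately show "\<bar>sin (h * t)\<bar> \<le> sin (h * l)" by simp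
  qed
  have pt: "pi * \<bar>t\<bar> \<le> pi * l" "0 \<le> pi * \<bar>t\<bar>" "pi * l \<le> pi / 4" using t by auto
  have "\<bar>sin (pi * t)\<bar> \<le> sin (pi * l)"
  proof -
    have "sin (pi * \<bar>t\<bar>) \<ge> 0" using pt by (intro sin_ge_zero) auto
    then have "\<bar>sin (pi * t)\<bar> = sin (pi * \<bar>t\<bar>)" by (cases "t \<ge> 0") auto
    moreover have "sin (pi * \<bar>t\<bar>) \<le> sin (pi * l)" by (rule sin_monotone_2pi_le) (use pt pi_gt_zero in linarith)+
    ultimately show ?thesis by simp
  qed
  then have N2: "\<bar>sin (pi * t) * sin (h * t)\<bar> \<le> sin (pi * l) * sin (h * l)"
    unfolding abs_mult using s by (intro mult_mono) auto
  have "cos (pi * \<bar>t\<bar>) \<ge> 0" by (rule cos_ge_zero) (use pt pi_gt_zero in linarith)+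
  then have ca: "\<bar>cos (pi * t)\<bar> = cos (pi * \<bar>t\<bar>)" by (cases "t \<ge> 0") auto
  have N1: "\<bar>cos (pi * t) * sin (h * t)\<bar> \<le> cos (pi * l) * sin (h * l)"
    unfolding abs_mult s(3) ca using cos_pi_mult_sin_mono[of "\<bar>t\<bar>" l h] t h by auto
  have *: "\<bar>a / D t\<bar> \<le> b / D l" if "\<bar>a\<bar> \<le> b" for a b
    unfolding abs_divide using Dl Dt that by (intro frac_le) auto
  have e: "2 * pi * x / real L = h * x" for x by (simp add: h_def)
  show "\<bar>odd_coeff L q t\<bar> \<le> odd_coeff L q l"
    using *[OF N1] unfolding odd_coeff_def e D_def .
  show "\<bar>even_coeff L q t\<bar> \<le> even_coeff L q l"
    using *[OF N2] unfolding even_coeff_def e D_def .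
qed

lemma mean_coeff_bounds:
  assumes L: "L > 0" and t: "\<bar>t\<bar> \<le> l" "l \<le> 1 / 4"
  shows "mean_coeff L l \<le> mean_coeff L t" "mean_coeff L t \<le> 1" "0 \<le> mean_coeff L t"
proof -
  have x: "\<bar>pi - 2 * pi * real n / real L\<bar> \<le> pi" if "n < L" for n
    using that L by (auto simp: abs_le_iff divide_simps)
  have ineq: "cos (l * x) \<le> cos (t * x) \<and> 0 \<le> cos (t * x)" if "\<bar>x\<bar> \<le> pi" for x
  proof -
    have a: "\<bar>t * x\<bar> \<le> \<bar>l * x\<bar>" unfolding abs_mult using t by (intro mult_right_mono) auto
    have b: "\<bar>l * x\<bar> \<le> 1 / 4 * pi" unfolding abs_mult using t that by (intro mult_mono) auto
    have c: "cos \<bar>l * x\<bar> \<le> cos \<bar>t * x\<bar>" by (rule cos_monotone_0_pi_le) (use a b in auto)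
    have d: "0 \<le> cos \<bar>t * x\<bar>" by (rule cos_ge_zero) (use a b in auto)
    show ?thesis using c d by simp
  qed
  show "mean_coeff L l \<le> mean_coeff L t" unfolding mean_coeff_def
    using ineq x by (intro divide_right_mono sum_mono) auto
  show "0 \<le> mean_coeff L t" unfolding mean_coeff_def
    using ineq x by (intro divide_nonneg_nonneg sum_nonneg) auto
  have "(\<Sum>n<L. cos (t * (pi - 2 * pi * real n / real L))) \<le> (\<Sum>n<L. 1)" by (intro sum_mono) simp
  then show "mean_coeff L t \<le> 1" unfolding mean_coeff_def using L by simp
qed

lemma mult_cos_le_sin:
  assumes "0 \<le> y" "y \<le> pi"
  shows "y * cos y \<le> sin (y::real)"
proof -
  have "sin 0 - 0 * cos 0 \<le> sin y - y * cos y"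
  proof (rule DERIV_nonneg_imp_nondecreasing[OF assms(1)])
    fix x assume "0 \<le> x" "x \<le> y"
    then have "0 \<le> x * sin x" using assms by (intro mult_nonneg_nonneg sin_ge_zero) auto
    then show "\<exists>z. ((\<lambda>a. sin a - a * cos a) has_real_derivative z) (at x) \<and> 0 \<le> z"
      by (intro exI[of _ "x * sin x"] conjI) (auto intro!: derivative_eq_intros)
  qed
  then show ?thesis by simp
qed

text \<open>The average is a trapezoidal sum for the integral of the concave function \<open>x \<mapsto> cos (t x)\<close> over
  \<open>[-\<pi>, \<pi>]\<close>, hence not larger than the integral average. The closed form turns this into
  \<open>y cos y \<le> sin y\<close>.\<close>

lemma mean_coeff_le_sinc:
  assumes L: "L > 1" and t: "0 \<le> t" "t < 1 / 2"
  shows "mean_coeff L t \<le> sinc_pi t"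
proof (cases "t = 0")
  case True
  then show ?thesis using L by (simp add: mean_coeff_def sinc_pi_def)
next
  case False
  define y where "y = pi * t / real L"
  have "pi * t \<le> pi * (1 / 2)" using t by (intro mult_left_mono) auto
  then have y: "0 < y" "y < pi"
    using False t L pi_gt_zero unfolding y_def by (auto simp: divide_simps)
  have yt: "2 * pi * t / real L = 2 * y" "pi * t = real L * y" using L by (simp_all add: y_def)
  have sy: "sin y > 0" using y by (intro sin_gt_zero) auto
  have "mean_coeff L t = sin (pi * t) * (2 * sin y * cos y) / (real L * (2 * (sin y)\<^sup>2))"
    using mean_coeff_closed_form[of L t] L t False 
    by (simp add: even_coeff_def yt(1) sin_double cos_double_sin)
  also have "\<dots> = sin (pi * t) * cos y / (real L * sin y)"
    using sy by (simp add: power2_eq_square)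
  also have "\<dots> \<le> sin (pi * t) / (real L * y)"
  proof -
    have "0 \<le> sin (pi * t)" using t by (intro sin_ge_zero) auto
    moreover have "cos y / sin y \<le> 1 / y" using mult_cos_le_sin[of y] y sy by (simp add: divide_simps mult.commute)
    ultimately have "sin (pi * t) / real L * (cos y / sin y) \<le> sin (pi * t) / real L * (1 / y)"
      by (intro mult_left_mono) auto
    then show ?thesis by simp
  qed
  finally show ?thesis using False by (simp add: sinc_pi_def yt(2))
qed


section \<open>Kadec expansion of a phase on a grid\<close>

text \<open>Even \<open>q\<close> carry the real part and odd \<open>q\<close> the imaginary part of \<open>exp (- i t x)\<close>.\<close>

definition kadec_coeff :: "nat \<Rightarrow> real \<Rightarrow> nat \<Rightarrow> complex" where
  "kadec_coeff L t q = (if q = 0 then of_real (mean_coeff L t)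
      else if even q then of_real (- even_coeff L q t) else - \<i> * of_real (odd_coeff L q t))"

definition kadec_bound :: "nat \<Rightarrow> real \<Rightarrow> nat \<Rightarrow> real" where
  "kadec_bound L l q = (if even q then even_coeff L q l else odd_coeff L q l)"

lemma sum_even_odd: "(\<Sum>q<2 * L. f q) = (\<Sum>p<L. f (2 * p)) + (\<Sum>p<L. f (2 * p + 1))"
  for f :: "nat \<Rightarrow> 'a :: comm_monoid_add" and L :: nat
  by (induction L) (simp_all add: algebra_simps)

lemma kadec_expansion:
  assumes "L > 1" "\<bar>t\<bar> < 1 / 2" "n \<le> L"
  shows "(\<Sum>q<2 * L. kadec_coeff L t q * of_real (cos (pi * real q * real n / real L)))
       = cis (- t * (pi - 2 * pi * real n / real L))"
proof -
  define x where "x = t * (pi - 2 * pi * real n / real L)"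
  define f where "f = (\<lambda>q. kadec_coeff L t q * of_real (cos (pi * real q * real n / real L)))"
  have "{..<L} = insert 0 {1..<L}" using assms by auto
  then have "(\<Sum>p<L. f (2 * p)) = f 0 + (\<Sum>p=1..<L. f (2 * p))" by simp
  also have "\<dots> = of_real (mean_coeff L t - (\<Sum>p=1..<L. even_coeff L (2 * p) t * cos (pi * real (2 * p) * real n / real L)))"
    by (simp add: f_def kadec_coeff_def sum_negf)
  also have "\<dots> = of_real (cos x)" unfolding x_def by (subst even_cosine_expansion) (use assms in auto)
  finally have e: "(\<Sum>p<L. f (2 * p)) = of_real (cos x)" .
  have "(\<Sum>p<L. f (2 * p + 1)) = - \<i> * of_real (\<Sum>p<L. odd_coeff L (2 * p + 1) t * cos (pi * real (2 * p + 1) * real n / real L))"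
    unfolding of_real_sum sum_distrib_left by (intro sum.cong refl) (simp add: f_def kadec_coeff_def)
  also have "\<dots> = - \<i> * of_real (sin x)" unfolding x_def by (subst odd_cosine_expansion) (use assms in auto)
  finally have o: "(\<Sum>p<L. f (2 * p + 1)) = - \<i> * of_real (sin x)" .
  have "(\<Sum>q<2 * L. f q) = cis (- x)"
    unfolding sum_even_odd e o by (simp add: complex_eq_iff)
  then show ?thesis by (simp add: f_def x_def)
qed

lemma kadec_coeff_bound:
  assumes "L > 3" "\<bar>t\<bar> \<le> l" "l \<le> 1 / 4" "0 < q" "q < 2 * L"
  shows "cmod (kadec_coeff L t q) \<le> kadec_bound L l q"
  using coeff_bounds[OF assms(1,4,5,2,3)] assms(4)
  by (auto simp: kadec_coeff_def kadec_bound_def norm_mult)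

text \<open>At \<open>n = 0\<close> every cosine of the expansion equals one, so the sum of the bounds, which are the
  coefficients at \<open>t = l\<close> up to sign, is given by the values of \<open>cos\<close> and \<open>sin\<close> at \<open>\<pi> l\<close>.\<close>

lemma sum_kadec_bound:
  assumes "L > 3" "0 \<le> l" "l \<le> 1 / 4"
  shows "(\<Sum>q=1..<2 * L. kadec_bound L l q) = mean_coeff L l - cos (pi * l) + sin (pi * l)"
proof -
  define f where "f = (\<lambda>q. if q = 0 then 0 else kadec_bound L l q)"
  have "{..<2 * L} = insert 0 {1..<2 * L}" using assms by auto
  then have "(\<Sum>q=1..<2 * L. kadec_bound L l q) = (\<Sum>q<2 * L. f q)"
    by (simp add: f_def)
  also have "\<dots> = (\<Sum>p<L. f (2 * p)) + (\<Sum>p<L. f (2 * p + 1))" by (rule sum_even_odd)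
  also have "(\<Sum>p<L. f (2 * p + 1)) = sin (pi * l)"
    using odd_cosine_expansion[of L l 0] assms by (simp add: f_def kadec_bound_def mult.commute)
  also have "(\<Sum>p<L. f (2 * p)) = (\<Sum>p=1..<L. f (2 * p))"
  proof -
    have "{..<L} = insert 0 {1..<L}" using assms by auto
    then show ?thesis by (simp add: f_def)
  qed
  also have "\<dots> = mean_coeff L l - cos (pi * l)"
    using even_cosine_expansion[of L l 0] assms by (simp add: f_def kadec_bound_def mult.commute)
  finally show ?thesis by simp
qed

section \<open>Perturbation of kernels in the Euclidean norm\<close>

definition l2norm :: "'a set \<Rightarrow> ('a \<Rightarrow> complex) \<Rightarrow> real" where
  "l2norm J f = L2_set (\<lambda>j. cmod (f j)) J"

lemma l2norm_power2: "(l2norm J f)\<^sup>2 = (\<Sum>j\<in>J. (cmod (f j))\<^sup>2)"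
  unfolding l2norm_def L2_set_def by (simp add: sum_nonneg)

lemma l2norm_nonneg [simp]: "0 \<le> l2norm J f"
  by (simp add: l2norm_def)

lemma l2norm_cong: "(\<And>j. j \<in> J \<Longrightarrow> cmod (f j) = cmod (g j)) \<Longrightarrow> l2norm J f = l2norm J g"
  unfolding l2norm_def by (rule L2_set_cong) auto

lemma l2norm_mono: "(\<And>j. j \<in> J \<Longrightarrow> cmod (f j) \<le> cmod (g j)) \<Longrightarrow> l2norm J f \<le> l2norm J g"
  unfolding l2norm_def by (rule L2_set_mono) auto

lemma l2norm_add: "l2norm J (\<lambda>j. f j + g j) \<le> l2norm J f + l2norm J g"
proof -
  have "l2norm J (\<lambda>j. f j + g j) \<le> L2_set (\<lambda>j. cmod (f j) + cmod (g j)) J"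
    unfolding l2norm_def by (rule L2_set_mono) (auto intro: norm_triangle_ineq)
  also have "\<dots> \<le> l2norm J f + l2norm J g"
    unfolding l2norm_def by (rule L2_set_triangle_ineq)
  finally show ?thesis .
qed

lemma l2norm_sum:
  "finite I \<Longrightarrow> l2norm J (\<lambda>j. \<Sum>i\<in>I. f i j) \<le> (\<Sum>i\<in>I. l2norm J (f i))"
proof (induction I rule: finite_induct)
  case empty
  then show ?case by (simp add: l2norm_def L2_set_def)
next
  case (insert i I)
  then show ?case using l2norm_add[of J "f i" "\<lambda>j. \<Sum>i\<in>I. f i j"] by simp
qed

lemma l2norm_mult_bounded:
  assumes "\<And>j. j \<in> J \<Longrightarrow> cmod (a j) \<le> b" "0 \<le> b"
  shows "l2norm J (\<lambda>j. a j * f j) \<le> b * l2norm J f"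
proof -
  have "l2norm J (\<lambda>j. a j * f j) \<le> L2_set (\<lambda>j. b * cmod (f j)) J"
    unfolding l2norm_def by (rule L2_set_mono) (auto simp: norm_mult intro: mult_right_mono assms)
  also have "\<dots> = b * l2norm J f" unfolding l2norm_def by (rule L2_set_right_distrib[symmetric]) fact
  finally show ?thesis .
qed

text \<open>The mechanism of Kadec's proof. Unimodular row factors do not change norms. Apart from them, the change
  from \<open>T\<close> to \<open>T'\<close> is a sum of terms in which a small row factor multiplies \<open>T\<close> applied to \<open>\<phi> p \<cdot> c\<close>, so
  the triangle inequality bounds it as soon as the column multipliers \<open>\<phi> p\<close> do not increase the norm of the
  image. The index \<open>p0\<close> belongs to the constant multiplier, whose coefficient is close to one.\<close>

lemma perturbation_bound:
  fixes T T' :: "'j \<Rightarrow> 'm \<Rightarrow> complex" and \<phi> :: "'p \<Rightarrow> 'm \<Rightarrow> complex"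
  assumes P: "finite P" "p0 \<in> P"
    and T': "\<And>j m. j \<in> J \<Longrightarrow> m \<in> X \<Longrightarrow> T' j m = \<rho> j * (T j m * (\<Sum>p\<in>P. a p j * \<phi> p m))"
    and \<rho>: "\<And>j. j \<in> J \<Longrightarrow> cmod (\<rho> j) = 1"
    and \<phi>0: "\<And>m. m \<in> X \<Longrightarrow> \<phi> p0 m = 1"
    and a: "\<And>p j. p \<in> P \<Longrightarrow> j \<in> J \<Longrightarrow> cmod (a p j - (if p = p0 then 1 else 0)) \<le> \<beta> p"
    and \<beta>: "\<And>p. p \<in> P \<Longrightarrow> 0 \<le> \<beta> p"
    and K: "\<And>p. p \<in> P \<Longrightarrow> l2norm J (\<lambda>j. \<Sum>m\<in>X. T j m * (\<phi> p m * c m)) \<le> l2norm J (\<lambda>j. \<Sum>m\<in>X. T j m * c m)"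
  shows "(1 - sum \<beta> P) * l2norm J (\<lambda>j. \<Sum>m\<in>X. T j m * c m) \<le> l2norm J (\<lambda>j. \<Sum>m\<in>X. T' j m * c m)"
    and "l2norm J (\<lambda>j. \<Sum>m\<in>X. T' j m * c m) \<le> (1 + sum \<beta> P) * l2norm J (\<lambda>j. \<Sum>m\<in>X. T j m * c m)"
proof -
  define Tc where "Tc = (\<lambda>j. \<Sum>m\<in>X. T j m * c m)"
  define G where "G = (\<lambda>j. \<Sum>p\<in>P. a p j * (\<Sum>m\<in>X. T j m * (\<phi> p m * c m)))"
  define E where "E = (\<lambda>j. \<Sum>p\<in>P. (a p j - (if p = p0 then 1 else 0)) * (\<Sum>m\<in>X. T j m * (\<phi> p m * c m)))"
  have G: "l2norm J (\<lambda>j. \<Sum>m\<in>X. T' j m * c m) = l2norm J G"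
  proof (rule l2norm_cong)
    fix j assume j: "j \<in> J"
    have "(\<Sum>m\<in>X. T' j m * c m) = \<rho> j * (\<Sum>m\<in>X. \<Sum>p\<in>P. a p j * (T j m * (\<phi> p m * c m)))"
      unfolding sum_distrib_left
      by (intro sum.cong refl) (simp add: T'[OF j] sum_distrib_left sum_distrib_right mult_ac)
    also have "(\<Sum>m\<in>X. \<Sum>p\<in>P. a p j * (T j m * (\<phi> p m * c m))) = G j"
      unfolding G_def sum_distrib_left by (rule sum.swap)
    finally show "cmod (\<Sum>m\<in>X. T' j m * c m) = cmod (G j)" by (simp add: norm_mult \<rho>[OF j])
  qed
  have E: "G = (\<lambda>j. Tc j + E j)"
  proof (rule ext)
    fix j
    have "(\<Sum>p\<in>P. (if p = p0 then 1 else 0) * (\<Sum>m\<in>X. T j m * (\<phi> p m * c m)))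
        = (\<Sum>p\<in>P. if p = p0 then (\<Sum>m\<in>X. T j m * (\<phi> p m * c m)) else 0)"
      by (intro sum.cong refl) simp
    also have "\<dots> = Tc j" using P \<phi>0 by (simp add: Tc_def)
    finally have "E j = G j - Tc j"
      unfolding E_def G_def left_diff_distrib sum_subtractf by simp
    then show "G j = Tc j + E j" by simp
  qed
  have "l2norm J E \<le> (\<Sum>p\<in>P. l2norm J (\<lambda>j. (a p j - (if p = p0 then 1 else 0)) * (\<Sum>m\<in>X. T j m * (\<phi> p m * c m))))"
    unfolding E_def by (rule l2norm_sum[OF P(1)])
  also have "\<dots> \<le> (\<Sum>p\<in>P. \<beta> p * l2norm J Tc)"
  proof (rule sum_mono)
    fix p assume p: "p \<in> P"
    have "l2norm J (\<lambda>j. (a p j - (if p = p0 then 1 else 0)) * (\<Sum>m\<in>X. T j m * (\<phi> p m * c m)))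
        \<le> \<beta> p * l2norm J (\<lambda>j. \<Sum>m\<in>X. T j m * (\<phi> p m * c m))"
      by (rule l2norm_mult_bounded) (use a \<beta> p in auto)
    also have "\<dots> \<le> \<beta> p * l2norm J Tc" unfolding Tc_def using K \<beta> p by (intro mult_left_mono) auto
    finally show "l2norm J (\<lambda>j. (a p j - (if p = p0 then 1 else 0)) * (\<Sum>m\<in>X. T j m * (\<phi> p m * c m)))
        \<le> \<beta> p * l2norm J Tc" .
  qed
  finally have EB: "l2norm J E \<le> sum \<beta> P * l2norm J Tc" by (simp add: sum_distrib_right)
  have "l2norm J G \<le> l2norm J Tc + l2norm J E" unfolding E by (rule l2norm_add)
  with EB G show "l2norm J (\<lambda>j. \<Sum>m\<in>X. T' j m * c m) \<le> (1 + sum \<beta> P) * l2norm J (\<lambda>j. \<Sum>m\<in>X. T j m * c m)"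
    by (simp add: Tc_def algebra_simps)
  have "l2norm J Tc \<le> l2norm J G + l2norm J (\<lambda>j. - E j)"
    using l2norm_add[of J G "\<lambda>j. - E j"] by (simp add: E)
  also have "l2norm J (\<lambda>j. - E j) = l2norm J E" by (rule l2norm_cong) simp
  finally show "(1 - sum \<beta> P) * l2norm J (\<lambda>j. \<Sum>m\<in>X. T j m * c m) \<le> l2norm J (\<lambda>j. \<Sum>m\<in>X. T' j m * c m)"
    using EB G by (simp add: Tc_def algebra_simps)
qed


lemma l2norm_sum_orthogonal:
  assumes "finite V"
    and orth: "\<And>v w. v \<in> V \<Longrightarrow> w \<in> V \<Longrightarrow> v \<noteq> w \<Longrightarrow> (\<Sum>j\<in>J. f v j * cnj (f w j)) = 0"
  shows "(l2norm J (\<lambda>j. \<Sum>v\<in>V. f v j))\<^sup>2 = (\<Sum>v\<in>V. (l2norm J (f v))\<^sup>2)"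
proof -
  have "complex_of_real ((l2norm J (\<lambda>j. \<Sum>v\<in>V. f v j))\<^sup>2)
      = (\<Sum>j\<in>J. \<Sum>v\<in>V. \<Sum>w\<in>V. f v j * cnj (f w j))"
    unfolding l2norm_power2 of_real_sum complex_norm_square cnj_sum sum_product ..
  also have "\<dots> = (\<Sum>v\<in>V. \<Sum>j\<in>J. \<Sum>w\<in>V. f v j * cnj (f w j))" by (rule sum.swap)
  also have "\<dots> = (\<Sum>v\<in>V. \<Sum>w\<in>V. \<Sum>j\<in>J. f v j * cnj (f w j))"
    by (intro sum.cong refl sum.swap)
  also have "\<dots> = (\<Sum>v\<in>V. \<Sum>w\<in>V. if w = v then (\<Sum>j\<in>J. f v j * cnj (f v j)) else 0)"
    using orth by (intro sum.cong refl) auto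
  also have "\<dots> = complex_of_real (\<Sum>v\<in>V. (l2norm J (f v))\<^sup>2)"
    unfolding l2norm_power2 of_real_sum complex_norm_square
    using assms(1) by (simp add: sum.delta)
  finally show ?thesis unfolding of_real_eq_iff .
qed

lemma l2norm_block_decomposition:
  fixes T :: "'j \<Rightarrow> 'm \<Rightarrow> complex" and \<kappa> :: "'m \<Rightarrow> 'v"
  assumes X: "finite X"
    and orth: "\<And>m n. m \<in> X \<Longrightarrow> n \<in> X \<Longrightarrow> \<kappa> m \<noteq> \<kappa> n \<Longrightarrow> (\<Sum>j\<in>J. T j m * cnj (T j n)) = 0"
  shows "(l2norm J (\<lambda>j. \<Sum>m\<in>X. T j m * c m))\<^sup>2
     = (\<Sum>v\<in>\<kappa> ` X. (l2norm J (\<lambda>j. \<Sum>m\<in>{m \<in> X. \<kappa> m = v}. T j m * c m))\<^sup>2)"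
proof -
  have "(\<lambda>j. \<Sum>m\<in>X. T j m * c m) = (\<lambda>j. \<Sum>v\<in>\<kappa> ` X. \<Sum>m\<in>{m \<in> X. \<kappa> m = v}. T j m * c m)"
    by (intro ext sum.image_gen X)
  moreover have "(l2norm J (\<lambda>j. \<Sum>v\<in>\<kappa> ` X. \<Sum>m\<in>{m \<in> X. \<kappa> m = v}. T j m * c m))\<^sup>2
     = (\<Sum>v\<in>\<kappa> ` X. (l2norm J (\<lambda>j. \<Sum>m\<in>{m \<in> X. \<kappa> m = v}. T j m * c m))\<^sup>2)"
  proof (rule l2norm_sum_orthogonal)
    fix v w :: 'v assume vw: "v \<noteq> w"
    have "(\<Sum>j\<in>J. (\<Sum>m\<in>{m \<in> X. \<kappa> m = v}. T j m * c m) * cnj (\<Sum>m\<in>{m \<in> X. \<kappa> m = w}. T j m * c m))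
      = (\<Sum>j\<in>J. \<Sum>m\<in>{m \<in> X. \<kappa> m = v}. \<Sum>n\<in>{m \<in> X. \<kappa> m = w}. c m * cnj (c n) * (T j m * cnj (T j n)))"
      unfolding cnj_sum sum_product by (intro sum.cong refl) (simp add: mult_ac)
    also have "\<dots> = (\<Sum>m\<in>{m \<in> X. \<kappa> m = v}. \<Sum>j\<in>J. \<Sum>n\<in>{m \<in> X. \<kappa> m = w}. c m * cnj (c n) * (T j m * cnj (T j n)))"
      by (rule sum.swap)
    also have "\<dots> = (\<Sum>m\<in>{m \<in> X. \<kappa> m = v}. \<Sum>n\<in>{m \<in> X. \<kappa> m = w}. \<Sum>j\<in>J. c m * cnj (c n) * (T j m * cnj (T j n)))"
      by (intro sum.cong refl sum.swap)
    also have "\<dots> = 0"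
      unfolding sum_distrib_left[symmetric] using orth vw by (intro sum.neutral ballI) auto
    finally show "(\<Sum>j\<in>J. (\<Sum>m\<in>{m \<in> X. \<kappa> m = v}. T j m * c m) * cnj (\<Sum>m\<in>{m \<in> X. \<kappa> m = w}. T j m * c m)) = 0" .
  qed (use X in auto)
  ultimately show ?thesis by simp
qed

text \<open>When columns in different blocks are orthogonal, the image norm is assembled from the blocks by
  Pythagoras, and a multiplier that is constant on each block merely scales the contributions.\<close>

lemma l2norm_block_multiplier:
  fixes T :: "'j \<Rightarrow> 'm \<Rightarrow> complex" and \<kappa> :: "'m \<Rightarrow> 'v"
  assumes X: "finite X"
    and orth: "\<And>m n. m \<in> X \<Longrightarrow> n \<in> X \<Longrightarrow> \<kappa> m \<noteq> \<kappa> n \<Longrightarrow> (\<Sum>j\<in>J. T j m * cnj (T j n)) = 0"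
    and g: "\<And>v. cmod (g v) \<le> 1"
  shows "l2norm J (\<lambda>j. \<Sum>m\<in>X. T j m * (g (\<kappa> m) * c m)) \<le> l2norm J (\<lambda>j. \<Sum>m\<in>X. T j m * c m)"
proof (rule power2_le_imp_le)
  have "(l2norm J (\<lambda>j. \<Sum>m\<in>X. T j m * (g (\<kappa> m) * c m)))\<^sup>2
     = (\<Sum>v\<in>\<kappa> ` X. (l2norm J (\<lambda>j. \<Sum>m\<in>{m \<in> X. \<kappa> m = v}. T j m * (g (\<kappa> m) * c m)))\<^sup>2)"
    by (rule l2norm_block_decomposition[OF X orth])
  also have "\<dots> \<le> (\<Sum>v\<in>\<kappa> ` X. (l2norm J (\<lambda>j. \<Sum>m\<in>{m \<in> X. \<kappa> m = v}. T j m * c m))\<^sup>2)"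
  proof (intro sum_mono power_mono l2norm_mono)
    fix v :: 'v and j
    have "(\<Sum>m\<in>{m \<in> X. \<kappa> m = v}. T j m * (g (\<kappa> m) * c m)) = g v * (\<Sum>m\<in>{m \<in> X. \<kappa> m = v}. T j m * c m)"
      unfolding sum_distrib_left by (intro sum.cong refl) auto
    then show "cmod (\<Sum>m\<in>{m \<in> X. \<kappa> m = v}. T j m * (g (\<kappa> m) * c m))
        \<le> cmod (\<Sum>m\<in>{m \<in> X. \<kappa> m = v}. T j m * c m)"
      using g[of v] by (simp add: norm_mult mult_left_le_one_le)
  qed simp
  also have "\<dots> = (l2norm J (\<lambda>j. \<Sum>m\<in>X. T j m * c m))\<^sup>2"
    by (rule l2norm_block_decomposition[OF X orth, symmetric])
  finally show "(l2norm J (\<lambda>j. \<Sum>m\<in>X. T j m * (g (\<kappa> m) * c m)))\<^sup>2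
     \<le> (l2norm J (\<lambda>j. \<Sum>m\<in>X. T j m * c m))\<^sup>2" .
qed simp

section \<open>The sampling kernel and its unperturbed columns\<close>

lemma mem_Omega_iff: "j \<in> Omega M \<longleftrightarrow> (\<forall>k. 0 \<le> j $ k \<and> j $ k < int (M $ k))"
proof -
  have "real_of_int a < real n \<longleftrightarrow> a < int n" for a n
    by (metis of_int_less_iff of_int_of_nat_eq)
  then show ?thesis by (auto simp: Omega_def R_box_def of_int_vec_def)
qed

lemma Omega_bij: "bij_betw (\<lambda>g. \<chi> k. g k) (PiE UNIV (\<lambda>k. {0..<int (M $ k)})) (Omega M)"
  by (rule bij_betwI[where g = "\<lambda>j k. j $ k"]) (auto simp: mem_Omega_iff PiE_def Pi_def)

lemma finite_Omega: "finite (Omega M)"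
  using bij_betw_finite[OF Omega_bij] finite_PiE[of UNIV "\<lambda>k. {0..<int (M $ k)}"] by auto

text \<open>Summation over the box of a product of functions of single coordinates factorizes; all statements about
  separable kernels come down to one dimension through this identity.\<close>

lemma sum_Omega_prod:
  fixes f :: "'d::finite \<Rightarrow> int \<Rightarrow> 'a :: comm_semiring_1"
  shows "(\<Sum>j\<in>Omega M. \<Prod>k\<in>UNIV. f k (j $ k)) = (\<Prod>k\<in>UNIV. \<Sum>v\<in>{0..<int (M $ k)}. f k v)"
proof -
  have "(\<Sum>j\<in>Omega M. \<Prod>k\<in>UNIV. f k (j $ k))
     = (\<Sum>g\<in>PiE UNIV (\<lambda>k. {0..<int (M $ k)}). \<Prod>k\<in>UNIV. f k (g k))"
    using sum.reindex_bij_betw[OF Omega_bij, of "\<lambda>j. \<Prod>k\<in>UNIV. f k (j $ k)" M] by simp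
  also have "\<dots> = (\<Prod>k\<in>UNIV. \<Sum>v\<in>{0..<int (M $ k)}. f k v)"
    by (rule prod_sum_PiE[symmetric]) auto
  finally show ?thesis .
qed

definition sampling :: "nat ^ 'd \<Rightarrow> (int ^ 'd \<Rightarrow> 'd \<Rightarrow> real) \<Rightarrow> int ^ 'd \<Rightarrow> int ^ 'd \<Rightarrow> complex" where
  "sampling M \<theta> j m = (\<Prod>k\<in>UNIV. cis (2 * pi * (real_of_int (j $ k) + \<theta> j k) * real_of_int (m $ k) / real (M $ k)))"

lemma sum_cis_int_interval:
  assumes "\<bar>n\<bar> < int M"
  shows "(\<Sum>v\<in>{0..<int M}. cis (2 * pi * real_of_int v * real_of_int n / real M))
           = (if n = 0 then of_nat M else 0)"
proof -
  have "(\<Sum>v\<in>{0..<int M}. cis (2 * pi * real_of_int v * real_of_int n / real M))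
      = (\<Sum>p<M. cis (2 * pi * real p * real_of_int n / real M))"
    by (rule sum.reindex_bij_witness[of _ int nat]) auto
  also have "\<dots> = (if int M dvd n then of_nat M else 0)"
    by (rule sum_cis_roots_of_unity) (use assms in auto)
  also have "int M dvd n \<longleftrightarrow> n = 0" using assms zdvd_not_zless[of "\<bar>n\<bar>" "int M"] by auto
  finally show ?thesis .
qed

lemma sampling_gram:
  "(\<Sum>j\<in>Omega M. sampling M (\<lambda>j k. e k (j $ k)) j m * cnj (sampling M (\<lambda>j k. e k (j $ k)) j n))
     = (\<Prod>k\<in>UNIV. \<Sum>v\<in>{0..<int (M $ k)}.
          cis (2 * pi * (real_of_int v + e k v) * real_of_int (m $ k - n $ k) / real (M $ k)))"
  unfolding sum_Omega_prod[symmetric] sampling_def cnj_prod prod.distrib[symmetric] cis_cnj cis_mult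
  by (intro sum.cong prod.cong refl arg_cong[of _ _ cis]) (simp add: field_simps diff_divide_distrib)

text \<open>One coordinate factor of the inner product vanishes, namely a full sum of roots of unity.\<close>

lemma sampling_columns_orthogonal:
  assumes "m \<in> Omega M" "n \<in> Omega M" "m $ k \<noteq> n $ k" "\<And>v. e k v = 0"
  shows "(\<Sum>j\<in>Omega M. sampling M (\<lambda>j k. e k (j $ k)) j m * cnj (sampling M (\<lambda>j k. e k (j $ k)) j n)) = 0"
proof -
  have "\<bar>m $ k - n $ k\<bar> < int (M $ k)" using assms(1,2) unfolding mem_Omega_iff 
    by (smt (verit, best))
  then have "(\<Sum>v\<in>{0..<int (M $ k)}. cis (2 * pi * (real_of_int v + e k v) * real_of_int (m $ k - n $ k) / real (M $ k))) = 0"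
    using sum_cis_int_interval[of "m $ k - n $ k" "M $ k"] assms(3,4) by simp
  then show ?thesis unfolding sampling_gram by (intro prod_zero) auto
qed

lemma sampling_parseval:
  "l2norm (Omega M) (\<lambda>j. \<Sum>m\<in>Omega M. sampling M (\<lambda>_ _. 0) j m * c m)
     = sqrt (\<Prod>k\<in>UNIV. real (M $ k)) * l2norm (Omega M) c"
proof -
  have card: "card (Omega M) = (\<Prod>k\<in>UNIV. M $ k)"
    using bij_betw_same_card[OF Omega_bij, of M] by (simp add: card_PiE)
  have "(l2norm (Omega M) (\<lambda>j. \<Sum>m\<in>Omega M. sampling M (\<lambda>_ _. 0) j m * c m))\<^sup>2
     = (\<Sum>v\<in>(\<lambda>m. m) ` Omega M. (l2norm (Omega M) (\<lambda>j. \<Sum>m\<in>{m \<in> Omega M. m = v}. sampling M (\<lambda>_ _. 0) j m * c m))\<^sup>2)"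
  proof (rule l2norm_block_decomposition[OF finite_Omega])
    fix m n assume mn: "m \<in> Omega M" "n \<in> Omega M" "m \<noteq> n"
    then obtain k where "m $ k \<noteq> n $ k" by (auto simp: Finite_Cartesian_Product.vec_eq_iff)
    from sampling_columns_orthogonal[OF mn(1,2) this, of "\<lambda>_ _. 0"]
    show "(\<Sum>j\<in>Omega M. sampling M (\<lambda>_ _. 0) j m * cnj (sampling M (\<lambda>_ _. 0) j n)) = 0" by simp
  qed
  also have "\<dots> = (\<Sum>v\<in>Omega M. (\<Prod>k\<in>UNIV. real (M $ k)) * (cmod (c v))\<^sup>2)"
  proof -
    have "(l2norm (Omega M) (\<lambda>j. \<Sum>m\<in>{m \<in> Omega M. m = v}. sampling M (\<lambda>_ _. 0) j m * c m))\<^sup>2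
        = (\<Prod>k\<in>UNIV. real (M $ k)) * (cmod (c v))\<^sup>2" if v: "v \<in> Omega M" for v
    proof -
      have "{m \<in> Omega M. m = v} = {v}" using v by auto
      moreover have "cmod (sampling M (\<lambda>_ _. 0) j v) = 1" for j
        by (simp add: sampling_def prod_norm[symmetric])
      ultimately show ?thesis by (simp add: l2norm_power2 norm_mult card)
    qed
    then show ?thesis by simp
  qed
  also have "\<dots> = (sqrt (\<Prod>k\<in>UNIV. real (M $ k)) * l2norm (Omega M) c)\<^sup>2"
    by (simp add: power_mult_distrib l2norm_power2 sum_distrib_left prod_nonneg)
  finally show ?thesis by (rule power2_eq_imp_eq) (simp_all add: prod_nonneg)
qed

section \<open>Separable perturbations\<close>

text \<open>The points \<open>n / M\<close> are placed on a grid with \<open>4 M\<close> steps. The refinement guarantees a step of at most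
  \<open>\<pi> / 2\<close>, as the monotonicity of the coefficients requires, even for \<open>M = 1\<close>.\<close>

lemma kadec_phase:
  fixes M :: nat and n :: int
  assumes "0 \<le> n" "n < int M" "\<bar>t\<bar> < 1 / 2"
  shows "cis (2 * pi * t * real_of_int n / real M)
     = cis (pi * t) * (\<Sum>q<8 * M. kadec_coeff (4 * M) t q * of_real (cos (pi * real q * real_of_int n / real M)))"
proof -
  have M: "M > 0" using assms by auto
  have n: "real (4 * nat n) / real (4 * M) = real_of_int n / real M" using assms by simp
  have "(\<Sum>q<2 * (4 * M). kadec_coeff (4 * M) t q * of_real (cos (pi * real q * real (4 * nat n) / real (4 * M))))
       = cis (- t * (pi - 2 * pi * real (4 * nat n) / real (4 * M)))"
    by (rule kadec_expansion) (use assms M in auto)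
  then have "(\<Sum>q<8 * M. kadec_coeff (4 * M) t q * of_real (cos (pi * real q * real_of_int n / real M)))
       = cis (- t * (pi - 2 * pi * real_of_int n / real M))"
    unfolding times_divide_eq_right[symmetric] n by (simp add: mult.assoc)
  then show ?thesis by (simp add: cis_mult algebra_simps)
qed

lemma C_fun_le_1:
  assumes "0 \<le> l" "l \<le> 1 / 4"
  shows "C_fun l \<le> 1" 
proof -
  have "0 \<le> pi * l" "pi * l \<le> pi * (1 / 4)" using assms by auto
  then have "sin (pi * l) \<le> sin (pi / 2 - pi * l)" by (intro sin_monotone_2pi_le) linarith+
  then show ?thesis by (simp add: C_fun_def sin_diff)
qed

lemma C_fun_nonneg:
  assumes "0 \<le> l" "l \<le> 1 / 4"
  shows "0 \<le> C_fun l" 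
proof -
  have "0 \<le> sin (pi * l)" using assms by (intro sin_ge_zero) auto
  then show ?thesis using cos_le_one[of "pi * l"] unfolding C_fun_def by linarith
qed

text \<open>Switching on the perturbation in coordinate \<open>k\<close> multiplies the kernel by a Kadec phase in \<open>m_k\<close>. The
  kernel before the switch has orthogonal blocks of constant \<open>m_k\<close>, so the cosines of the expansion are
  admissible multipliers and the coefficient bounds add up to \<open>C l\<close>.\<close>

lemma perturb_one_coordinate:
  fixes M :: "nat ^ 'd" and e e' :: "'d \<Rightarrow> int \<Rightarrow> real" and c :: "int ^ 'd \<Rightarrow> complex"
  assumes M: "\<And>k. 1 \<le> M $ k" and l: "l \<le> 1 / 4"
    and e: "\<And>v. e k v = 0"
    and e': "\<And>v. 0 \<le> v \<Longrightarrow> v < int (M $ k) \<Longrightarrow> \<bar>e' k v\<bar> \<le> l" "\<And>i v. i \<noteq> k \<Longrightarrow> e' i v = e i v"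
  defines "F \<equiv> \<lambda>e. l2norm (Omega M) (\<lambda>j. \<Sum>m\<in>Omega M. sampling M (\<lambda>j k. e k (j $ k)) j m * c m)"
  shows "(1 - C_fun l) * F e \<le> F e'" "F e' \<le> (1 + C_fun l) * F e"
proof -
  define L where "L = 4 * M $ k"
  have L: "L > 3" using M[of k] by (simp add: L_def)
  have Mk: "0 < M $ k" using M[of k] by simp
  have l0: "0 \<le> l" using e'(1)[of 0] Mk by simp
  define \<beta> where "\<beta> = (\<lambda>q. if q = 0 then 1 - mean_coeff L l else kadec_bound L l q)"
  have "{..<2 * L} = insert 0 {1..<2 * L}" using L by auto
  then have "sum \<beta> {..<2 * L} = 1 - mean_coeff L l + (\<Sum>q=1..<2 * L. kadec_bound L l q)"
    by (simp add: \<beta>_def)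
  also have "\<dots> = C_fun l" using sum_kadec_bound[OF L l0 l] by (simp add: C_fun_def)
  finally have sum: "sum \<beta> {..<2 * L} = C_fun l" .
  define T where "T = sampling M (\<lambda>j k. e k (j $ k))"
  define T' where "T' = sampling M (\<lambda>j k. e' k (j $ k))"
  define a where "a = (\<lambda>q (j :: int ^ 'd). kadec_coeff L (e' k (j $ k)) q)"
  define \<phi> where "\<phi> = (\<lambda>q (m :: int ^ 'd). complex_of_real (cos (pi * real q * real_of_int (m $ k) / real (M $ k))))"
  define \<rho> where "\<rho> = (\<lambda>j :: int ^ 'd. cis (pi * e' k (j $ k)))"
  have small: "\<bar>e' k (j $ k)\<bar> \<le> l" if "j \<in> Omega M" for j
    using that e'(1) by (auto simp: mem_Omega_iff)
  have 1: "T' j m = \<rho> j * (T j m * (\<Sum>q\<in>{..<2 * L}. a q j * \<phi> q m))" if "j \<in> Omega M" "m \<in> Omega M" for j m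
  proof -
    have "T' j m = T j m * cis (2 * pi * e' k (j $ k) * real_of_int (m $ k) / real (M $ k))"
    proof -
      let ?f = "\<lambda>e i. cis (2 * pi * (real_of_int (j $ i) + e i (j $ i)) * real_of_int (m $ i) / real (M $ i))"
      have "(\<Prod>i\<in>UNIV - {k}. ?f e' i) = (\<Prod>i\<in>UNIV - {k}. ?f e i)"
        using e'(2) by (intro prod.cong refl) auto
      moreover have "?f e' k = ?f e k * cis (2 * pi * e' k (j $ k) * real_of_int (m $ k) / real (M $ k))"
        unfolding cis_mult by (simp add: e algebra_simps add_divide_distrib)
      ultimately show ?thesis unfolding T_def T'_def sampling_def
        by (subst (1 2) prod.remove[of UNIV k]) (simp_all add: mult_ac)
    qed
    also have "cis (2 * pi * e' k (j $ k) * real_of_int (m $ k) / real (M $ k))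
       = \<rho> j * (\<Sum>q\<in>{..<2 * L}. a q j * \<phi> q m)"
      using kadec_phase[of "m $ k" "M $ k" "e' k (j $ k)"] that small[OF that(1)] l
      by (simp add: mem_Omega_iff \<rho>_def a_def \<phi>_def L_def)
    finally show ?thesis by (simp add: mult_ac)
  qed
  have 2: "cmod (a q j - (if q = 0 then 1 else 0)) \<le> \<beta> q" if "q \<in> {..<2 * L}" "j \<in> Omega M" for q j
  proof (cases "q = 0")
    case True
    have "cmod (complex_of_real (mean_coeff L (e' k (j $ k))) - 1) = \<bar>mean_coeff L (e' k (j $ k)) - 1\<bar>"
      by (metis norm_of_real of_real_1 of_real_diff)
    then show ?thesis using True mean_coeff_bounds[OF _ small[OF that(2)] l, of L] L
      by (simp add: a_def \<beta>_def kadec_coeff_def)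
  next
    case False
    then show ?thesis using kadec_coeff_bound[OF L small[OF that(2)] l, of q] that(1)
      by (simp add: a_def \<beta>_def)
  qed
  have 3: "0 \<le> \<beta> q" if "q \<in> {..<2 * L}" for q
  proof -
    have "(\<chi> k. 0) \<in> Omega M" using M by (auto simp: mem_Omega_iff Suc_le_eq)
    from 2[OF that this] norm_ge_zero show ?thesis by (rule order_trans[rotated])
  qed
  have 4: "l2norm (Omega M) (\<lambda>j. \<Sum>m\<in>Omega M. T j m * (\<phi> q m * c m))
     \<le> l2norm (Omega M) (\<lambda>j. \<Sum>m\<in>Omega M. T j m * c m)" for q
    using l2norm_block_multiplier[where \<kappa> = "\<lambda>m. m $ k" and T = T and J = "Omega M" and X = "Omega M"
        and g = "\<lambda>v. complex_of_real (cos (pi * real q * real_of_int v / real (M $ k)))" and c = c,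
        OF finite_Omega]
      sampling_columns_orthogonal[of _ M _ k e] e
    unfolding T_def \<phi>_def by auto
  have 5: "\<phi> 0 m = 1" for m by (simp add: \<phi>_def)
  have 6: "cmod (\<rho> j) = 1" for j by (simp add: \<rho>_def)
  have "0 \<in> {..<2 * L}" using L by auto
  from perturbation_bound[where T' = T' and T = T and \<rho> = \<rho> and a = a and \<phi> = \<phi> and \<beta> = \<beta> and J = "Omega M"
      and X = "Omega M" and c = c and P = "{..<2 * L}" and ?p0.0 = 0, OF _ this 1 6 5 2 3 4]
  show "(1 - C_fun l) * F e \<le> F e'" "F e' \<le> (1 + C_fun l) * F e"
    unfolding sum F_def T_def T'_def by auto
qed

text \<open>Induction on the set of perturbed coordinates, starting from Parseval's identity. The lower bound
  multiplies because \<open>C l \<le> 1\<close>.\<close>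

lemma separable_sampling_bounds:
  fixes M :: "nat ^ 'd" and e :: "'d \<Rightarrow> int \<Rightarrow> real" and c :: "int ^ 'd \<Rightarrow> complex"
  assumes M: "\<And>k. 1 \<le> M $ k" and l: "0 \<le> l" "l \<le> 1 / 4"
    and e: "\<And>k v. 0 \<le> v \<Longrightarrow> v < int (M $ k) \<Longrightarrow> \<bar>e k v\<bar> \<le> l"
  defines "F \<equiv> \<lambda>e. l2norm (Omega M) (\<lambda>j. \<Sum>m\<in>Omega M. sampling M (\<lambda>j k. e k (j $ k)) j m * c m)"
  shows "(1 - C_fun l) ^ CARD('d) * (sqrt (\<Prod>k\<in>UNIV. real (M $ k)) * l2norm (Omega M) c) \<le> F e"
    and "F e \<le> (1 + C_fun l) ^ CARD('d) * (sqrt (\<Prod>k\<in>UNIV. real (M $ k)) * l2norm (Omega M) c)"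
proof -
  \<comment> \<open>The perturbation restricted to the coordinates in \<open>K\<close>.\<close>
  define eK where "eK = (\<lambda>K k v. if k \<in> K then e k v else 0)"
  define N where "N = sqrt (\<Prod>k\<in>UNIV. real (M $ k)) * l2norm (Omega M) c"
  have C: "0 \<le> C_fun l" "C_fun l \<le> 1" using C_fun_nonneg C_fun_le_1 l by auto
  have "finite K \<Longrightarrow> (1 - C_fun l) ^ card K * N \<le> F (eK K) \<and> F (eK K) \<le> (1 + C_fun l) ^ card K * N" for K
  proof (induction K rule: finite_induct)
    case empty
    show ?case using sampling_parseval[of M c] by (simp add: F_def eK_def N_def)
  next
    case (insert k K)
    have step: "(1 - C_fun l) * F (eK K) \<le> F (eK (insert k K))" "F (eK (insert k K)) \<le> (1 + C_fun l) * F (eK K)"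
      unfolding F_def
      by (rule perturb_one_coordinate[where k = k]; use insert M l e in \<open>auto simp: eK_def\<close>)+
    have "(1 - C_fun l) * ((1 - C_fun l) ^ card K * N) \<le> (1 - C_fun l) * F (eK K)"
      using insert C by (intro mult_left_mono) auto
    moreover have "(1 + C_fun l) * F (eK K) \<le> (1 + C_fun l) * ((1 + C_fun l) ^ card K * N)"
      using insert C by (intro mult_left_mono) auto
    ultimately show ?case using step insert by (simp add: mult.assoc)
  qed
  from this[of UNIV] show "(1 - C_fun l) ^ CARD('d) * (sqrt (\<Prod>k\<in>UNIV. real (M $ k)) * l2norm (Omega M) c) \<le> F e"
    and "F e \<le> (1 + C_fun l) ^ CARD('d) * (sqrt (\<Prod>k\<in>UNIV. real (M $ k)) * l2norm (Omega M) c)"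
    by (auto simp: eK_def N_def)
qed


section \<open>General perturbations\<close>

text \<open>Expanding the left-hand product leaves a polynomial in the \<open>s k\<close> with nonnegative coefficients, so it
  increases when every \<open>s k\<close> is raised to \<open>\<sigma>\<close>.\<close>

lemma prod_shift_diff_mono:
  fixes s :: "'k \<Rightarrow> real"
  assumes "finite K" "0 \<le> C" "\<And>k. k \<in> K \<Longrightarrow> 0 \<le> s k \<and> s k \<le> \<sigma>"
  shows "(\<Prod>k\<in>K. C + s k) - (\<Prod>k\<in>K. s k) \<le> (C + \<sigma>) ^ card K - \<sigma> ^ card K"
  using assms(1,3)
proof (induction K rule: finite_induct)
  case (insert k K)
  define P Q where "P = (\<Prod>k\<in>K. C + s k)" and "Q = (\<Prod>k\<in>K. s k)"
  have s: "0 \<le> s k" "s k \<le> \<sigma>" using insert.prems by auto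
  have IH: "P - Q \<le> (C + \<sigma>) ^ card K - \<sigma> ^ card K" using insert unfolding P_def Q_def by auto
  have PQ: "Q \<le> P" unfolding P_def Q_def using insert.prems assms(2) by (intro prod_mono) auto
  have "P \<le> (\<Prod>k\<in>K. C + \<sigma>)" unfolding P_def using insert.prems assms(2) by (intro prod_mono) auto
  then have P: "P \<le> (C + \<sigma>) ^ card K" by simp
  have "0 \<le> P" unfolding P_def using insert.prems assms(2) by (intro prod_nonneg) auto
  have "C * P + s k * (P - Q) \<le> C * (C + \<sigma>) ^ card K + \<sigma> * ((C + \<sigma>) ^ card K - \<sigma> ^ card K)"
    using s P PQ IH assms(2) \<open>0 \<le> P\<close> by (intro add_mono mult_mono) auto
  then show ?case using insert by (simp add: P_def[symmetric] Q_def[symmetric] algebra_simps)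
qed simp

text \<open>The perturbation may couple the coordinates, so the reference kernel is the unperturbed one throughout
  and multipliers may depend on all of \<open>m\<close>. The indices \<open>p\<close> are tuples of one-dimensional frequencies. The
  bounds over all tuples sum to \<open>\<Prod>(C + s k) - \<Prod> s k\<close>, where \<open>s k\<close> bounds the zero-frequency
  coefficient in coordinate \<open>k\<close> from below.\<close>

lemma sampling_bounds:
  fixes M :: "nat ^ 'd" and \<theta> :: "int ^ 'd \<Rightarrow> 'd \<Rightarrow> real" and c :: "int ^ 'd \<Rightarrow> complex"
  assumes M: "\<And>k. 1 \<le> M $ k" and l: "0 \<le> l" "l \<le> 1 / 4"
    and \<theta>: "\<And>j k. j \<in> Omega M \<Longrightarrow> \<bar>\<theta> j k\<bar> \<le> l"
  defines "F \<equiv> l2norm (Omega M) (\<lambda>j. \<Sum>m\<in>Omega M. sampling M \<theta> j m * c m)"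
    and "N \<equiv> sqrt (\<Prod>k\<in>UNIV. real (M $ k)) * l2norm (Omega M) c"
  shows "(1 - D_fun CARD('d) l) * N \<le> F" and "F \<le> (1 + D_fun CARD('d) l) * N"
proof -
  define L where "L = (\<lambda>k. 4 * M $ k)"
  have L: "L k > 3" "L k > 1" "L k > 0" for k using M[of k] by (simp_all add: L_def)
  define P where "P = PiE UNIV (\<lambda>k. {..<8 * M $ k})"
  have finP: "finite P" unfolding P_def by (intro finite_PiE) auto
  define p0 where "p0 = (\<lambda>_::'d. 0::nat)"
  have p0: "p0 \<in> P" using M by (auto simp: P_def p0_def PiE_def Suc_le_eq)
  define s where "s = (\<lambda>k. mean_coeff (L k) l)"
  define bd where "bd = (\<lambda>k q. if q = 0 then 1 else kadec_bound (L k) l q)"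
  define \<beta> where "\<beta> = (\<lambda>p. if p = p0 then 1 - (\<Prod>k\<in>UNIV. s k) else (\<Prod>k\<in>UNIV. bd k (p k)))"
  define a where "a = (\<lambda>p j. \<Prod>k\<in>UNIV. kadec_coeff (L k) (\<theta> j k) (p k))"
  define \<phi> where "\<phi> = (\<lambda>p (m :: int ^ 'd). \<Prod>k\<in>UNIV. complex_of_real (cos (pi * real (p k) * real_of_int (m $ k) / real (M $ k))))"
  define \<rho> where "\<rho> = (\<lambda>j. \<Prod>k\<in>UNIV. cis (pi * \<theta> j k))"
  have s: "0 \<le> s k" "s k \<le> 1" "s k \<le> sinc_pi l" for k
    using mean_coeff_bounds[of "L k" l l] mean_coeff_le_sinc[of "L k" l] L[of k] l by (auto simp: s_def)
  have coeff: "cmod (kadec_coeff (L k) (\<theta> j k) q) \<le> bd k q" if "j \<in> Omega M" "q < 8 * M $ k" for j k q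
  proof (cases "q = 0")
    case True
    then show ?thesis using mean_coeff_bounds[OF L(3) \<theta>[OF that(1)] l(2), of k k]
      by (simp add: bd_def kadec_coeff_def)
  next
    case False
    then show ?thesis using kadec_coeff_bound[OF L(1) \<theta>[OF that(1)] l(2), of q k k] that
      by (simp add: bd_def L_def)
  qed
  have 0: "(\<chi> k. 0) \<in> Omega M" using M by (auto simp: mem_Omega_iff Suc_le_eq)
  have bd: "0 \<le> bd k q" if "q < 8 * M $ k" for k q
    using coeff[OF 0 that] norm_ge_zero order_trans by blast
  have 1: "sampling M \<theta> j m = \<rho> j * (sampling M (\<lambda>_ _. 0) j m * (\<Sum>p\<in>P. a p j * \<phi> p m))"
    if "j \<in> Omega M" "m \<in> Omega M" for j m
  proof -
    have "(\<Sum>p\<in>P. a p j * \<phi> p m) = (\<Prod>k\<in>UNIV. \<Sum>q<8 * M $ k. kadec_coeff (L k) (\<theta> j k) q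
         * of_real (cos (pi * real q * real_of_int (m $ k) / real (M $ k))))"
      unfolding P_def a_def \<phi>_def prod.distrib[symmetric] by (rule prod_sum_PiE[symmetric]) auto
    then have "\<rho> j * (\<Sum>p\<in>P. a p j * \<phi> p m) = (\<Prod>k\<in>UNIV. cis (2 * pi * \<theta> j k * real_of_int (m $ k) / real (M $ k)))"
      unfolding \<rho>_def prod.distrib[symmetric] L_def
    proof (simp only: prod.distrib[symmetric], intro prod.cong refl kadec_phase[symmetric])
      fix k
      show "0 \<le> m $ k" "m $ k < int (M $ k)" using that by (auto simp: mem_Omega_iff)
      show "\<bar>\<theta> j k\<bar> < 1 / 2" using \<theta>[OF that(1), of k] l by simp
    qed
    then have "\<rho> j * (sampling M (\<lambda>_ _. 0) j m * (\<Sum>p\<in>P. a p j * \<phi> p m))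
      = sampling M (\<lambda>_ _. 0) j m * (\<Prod>k\<in>UNIV. cis (2 * pi * \<theta> j k * real_of_int (m $ k) / real (M $ k)))"
      by (simp add: mult_ac)
    also have "\<dots> = sampling M \<theta> j m"
      unfolding sampling_def prod.distrib[symmetric] cis_mult
      by (intro prod.cong refl arg_cong[of _ _ cis]) (simp add: algebra_simps add_divide_distrib)
    finally show ?thesis ..
  qed
  have 2: "cmod (a p j - (if p = p0 then 1 else 0)) \<le> \<beta> p" if p: "p \<in> P" and j: "j \<in> Omega M" for p j
  proof (cases "p = p0")
    case True
    have mb: "s k \<le> mean_coeff (L k) (\<theta> j k)" "0 \<le> mean_coeff (L k) (\<theta> j k)" "mean_coeff (L k) (\<theta> j k) \<le> 1" for k
      using mean_coeff_bounds[OF L(3) \<theta>[OF j] l(2), of k k] by (auto simp: s_def)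
    have "a p j = complex_of_real (\<Prod>k\<in>UNIV. mean_coeff (L k) (\<theta> j k))"
      using True by (simp add: a_def p0_def kadec_coeff_def)
    then have "cmod (a p j - 1) = \<bar>(\<Prod>k\<in>UNIV. mean_coeff (L k) (\<theta> j k)) - 1\<bar>"
      by (metis norm_of_real of_real_1 of_real_diff)
    moreover have "(\<Prod>k\<in>UNIV. mean_coeff (L k) (\<theta> j k)) \<le> 1" using mb by (intro prod_le_1) auto
    moreover have "(\<Prod>k\<in>UNIV. s k) \<le> (\<Prod>k\<in>UNIV. mean_coeff (L k) (\<theta> j k))"
      using mb s by (intro prod_mono) auto
    ultimately show ?thesis using True by (simp add: \<beta>_def)
  next
    case False
    have "cmod (a p j) \<le> (\<Prod>k\<in>UNIV. bd k (p k))"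
      unfolding a_def prod_norm[symmetric]
      by (intro prod_mono conjI norm_ge_zero coeff j) (use p in \<open>auto simp: P_def\<close>)
    then show ?thesis using False by (simp add: \<beta>_def)
  qed
  have 3: "0 \<le> \<beta> p" if "p \<in> P" for p
    using 2[OF that 0] norm_ge_zero by (rule order_trans[rotated])
  have 4: "l2norm (Omega M) (\<lambda>j. \<Sum>m\<in>Omega M. sampling M (\<lambda>_ _. 0) j m * (\<phi> p m * c m))
     \<le> l2norm (Omega M) (\<lambda>j. \<Sum>m\<in>Omega M. sampling M (\<lambda>_ _. 0) j m * c m)" for p
  proof -
    have "cmod (\<phi> p m) \<le> 1" for m
      unfolding \<phi>_def prod_norm[symmetric] by (intro prod_le_1) auto
    then have "l2norm (Omega M) (\<lambda>m. \<phi> p m * c m) \<le> 1 * l2norm (Omega M) c"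
      by (intro l2norm_mult_bounded) auto
    then show ?thesis unfolding sampling_parseval by (simp add: mult_left_mono prod_nonneg)
  qed
  have 5: "\<phi> p0 m = 1" for m by (simp add: \<phi>_def p0_def)
  have 6: "cmod (\<rho> j) = 1" for j by (simp add: \<rho>_def prod_norm[symmetric])
  have sum: "sum \<beta> P \<le> D_fun CARD('d) l"
  proof -
    have bsum: "(\<Sum>q<8 * M $ k. bd k q) = C_fun l + s k" for k
    proof -
      have "{..<8 * M $ k} = insert 0 {1..<2 * L k}" using M[of k] by (auto simp: L_def)
      then have "(\<Sum>q<8 * M $ k. bd k q) = 1 + (\<Sum>q=1..<2 * L k. kadec_bound (L k) l q)"
        by (simp add: bd_def)
      also have "\<dots> = C_fun l + s k"
        using sum_kadec_bound[OF L(1) l(1) l(2), of k] by (simp add: C_fun_def s_def)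
      finally show ?thesis .
    qed
    have "sum \<beta> P = 1 - (\<Prod>k\<in>UNIV. s k) + (\<Sum>p\<in>P - {p0}. \<Prod>k\<in>UNIV. bd k (p k))"
      by (subst sum.remove[OF finP p0]) (simp add: \<beta>_def)
    also have "(\<Sum>p\<in>P - {p0}. \<Prod>k\<in>UNIV. bd k (p k)) = (\<Sum>p\<in>P. \<Prod>k\<in>UNIV. bd k (p k)) - 1"
    proof -
      have "(\<Prod>k\<in>UNIV. bd k (p0 k)) = 1" by (simp add: bd_def p0_def)
      then show ?thesis using sum.remove[OF finP p0, of "\<lambda>p. \<Prod>k\<in>UNIV. bd k (p k)"] by simp
    qed
    also have "(\<Sum>p\<in>P. \<Prod>k\<in>UNIV. bd k (p k)) = (\<Prod>k\<in>UNIV. C_fun l + s k)"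
      unfolding P_def bsum[symmetric] by (rule prod_sum_PiE[symmetric]) auto
    finally have "sum \<beta> P = (\<Prod>k\<in>UNIV. C_fun l + s k) - (\<Prod>k\<in>UNIV. s k)" by simp
    also have "\<dots> \<le> (C_fun l + sinc_pi l) ^ CARD('d) - sinc_pi l ^ CARD('d)"
      using s C_fun_nonneg[OF l] by (intro prod_shift_diff_mono) auto
    finally show ?thesis by (simp add: D_fun_def C_fun_def)
  qed
  have N: "0 \<le> N" unfolding N_def by (simp add: prod_nonneg)
  have bounds: "(1 - sum \<beta> P) * N \<le> F" "F \<le> (1 + sum \<beta> P) * N"
    using perturbation_bound[where T' = "sampling M \<theta>" and T = "sampling M (\<lambda>_ _. 0)" and \<rho> = \<rho> and a = a
      and \<phi> = \<phi> and \<beta> = \<beta> and J = "Omega M"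
      and X = "Omega M" and c = c and P = P and ?p0.0 = p0, OF finP p0 1 6 5 2 3 4]
    unfolding F_def sampling_parseval N_def by auto
  have "(1 - D_fun CARD('d) l) * N \<le> (1 - sum \<beta> P) * N" using sum N by (intro mult_right_mono) auto
  with bounds show "(1 - D_fun CARD('d) l) * N \<le> F" by simp
  have "(1 + sum \<beta> P) * N \<le> (1 + D_fun CARD('d) l) * N" using sum N by (intro mult_right_mono) auto
  with bounds show "F \<le> (1 + D_fun CARD('d) l) * N" by simp
qed

section \<open>Vandermonde duality\<close>

text \<open>The entries are the coefficients of the Lagrange polynomials: interpolating \<open>X^n\<close> at the nodes
  reproduces \<open>X^n\<close>.\<close>

lemma vandermonde_left_inverse:
  fixes z :: "'i \<Rightarrow> 'a :: field"
  assumes "finite I" "inj_on z I"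
  obtains w where "\<And>n r. n < card I \<Longrightarrow> (\<Sum>j\<in>I. w r j * z j ^ n) = (if r = n then 1 else 0)"
proof -
  define lag where "lag = (\<lambda>j. \<Prod>i\<in>I - {j}. Polynomial.smult (1 / (z j - z i)) [:- z i, 1:])"
  have deg: "degree (lag j) < card I" if "j \<in> I" for j
  proof -
    have "degree (lag j) \<le> (\<Sum>i\<in>I - {j}. degree (Polynomial.smult (1 / (z j - z i)) [:- z i, 1:]))"
      unfolding lag_def using degree_prod_sum_le[of "I - {j}" "\<lambda>i. Polynomial.smult (1 / (z j - z i)) [:- z i, 1:]"] assms(1) by (simp add: o_def)
    also have "\<dots> \<le> (\<Sum>i\<in>I - {j}. 1)" by (intro sum_mono) (simp add: degree_smult_eq)
    also have "\<dots> < card I" using that assms(1) card_Diff1_less[of I j] by simp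
    finally show ?thesis .
  qed
  have val: "poly (lag j) (z i) = (if i = j then 1 else 0)" if "i \<in> I" "j \<in> I" for i j
  proof (cases "i = j")
    case True
    have "z j - z r \<noteq> 0" if "r \<in> I - {j}" for r
      using assms(2) that \<open>j \<in> I\<close> by (auto dest: inj_onD)
    then show ?thesis using True by (simp add: lag_def poly_prod diff_divide_distrib[symmetric])
  next
    case False
    then show ?thesis using that assms(1) by (auto simp: lag_def poly_prod intro!: prod_zero bexI[of _ i])
  qed
  have "(\<Sum>j\<in>I. coeff (lag j) r * z j ^ n) = (if r = n then 1 else 0)" if n: "n < card I" for n r
  proof -
    have "(\<Sum>j\<in>I. Polynomial.smult (z j ^ n) (lag j)) = monom 1 n"
    proof (rule poly_eqI_degree[where A = "z ` I"])
      fix x assume "x \<in> z ` I"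
      then obtain i where i: "i \<in> I" "x = z i" by auto
      have "poly (\<Sum>j\<in>I. Polynomial.smult (z j ^ n) (lag j)) x = (\<Sum>j\<in>I. if j = i then z i ^ n else 0)"
        unfolding poly_sum using i by (intro sum.cong refl) (auto simp: val)
      then show "poly (\<Sum>j\<in>I. Polynomial.smult (z j ^ n) (lag j)) x = poly (monom 1 n) x"
        using i assms(1) by (simp add: poly_monom)
    next
      have card: "card (z ` I) = card I" by (rule card_image) fact
      show "degree (\<Sum>j\<in>I. Polynomial.smult (z j ^ n) (lag j)) < card (z ` I)"
        unfolding card using n deg by (intro degree_sum_less) (auto intro: le_less_trans[OF degree_smult_le])
      show "degree (monom 1 n :: 'a poly) < card (z ` I)" unfolding card using n by (simp add: degree_monom_eq)
    qed
    then have "coeff (\<Sum>j\<in>I. Polynomial.smult (z j ^ n) (lag j)) r = coeff (monom 1 n) r" by simp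
    then show ?thesis by (auto simp: coeff_sum mult.commute split: if_splits)
  qed
  then show thesis by (rule that)
qed

text \<open>The kernel of a separable perturbation is a product of Vandermonde matrices with these nodes.\<close>

definition node :: "nat ^ 'd \<Rightarrow> ('d \<Rightarrow> int \<Rightarrow> real) \<Rightarrow> 'd \<Rightarrow> int \<Rightarrow> complex" where
  "node M e k v = cis (2 * pi * (real_of_int v + e k v) / real (M $ k))"

lemma sampling_eq_node_powers:
  assumes "m \<in> Omega M"
  shows "sampling M (\<lambda>j k. e k (j $ k)) j m = (\<Prod>k\<in>UNIV. node M e k (j $ k) ^ nat (m $ k))"
  unfolding sampling_def node_def Complex.DeMoivre
  using assms by (intro prod.cong refl arg_cong[of _ _ cis]) (simp add: mem_Omega_iff)

lemma node_eq_iff: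
  assumes "1 \<le> M $ k"
  shows "node M e k v = node M e k u \<longleftrightarrow>
     1 / real (M $ k) * (real_of_int v - real_of_int u + e k v - e k u) \<in> \<int>"
proof -
  define x where "x = 1 / real (M $ k) * (real_of_int v - real_of_int u + e k v - e k u)"
  have "node M e k v = node M e k u * cis (2 * pi * x)"
    unfolding node_def cis_mult x_def by (intro arg_cong[of _ _ cis]) (use assms in \<open>simp add: field_simps\<close>)
  moreover have "node M e k u \<noteq> 0" by (simp add: node_def)
  ultimately have "node M e k v = node M e k u \<longleftrightarrow> cis (2 * pi * x) = 1" by simp
  also have "\<dots> \<longleftrightarrow> x \<in> \<int>"
  proof
    assume "cis (2 * pi * x) = 1"
    then have "cos (2 * pi * x) = 1" by (metis cis.sel(1) one_complex.sel(1))
    then show "x \<in> \<int>" by (auto simp: cos_one_2pi_int)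
  qed (simp only: cis_multiple_2pi)
  finally show ?thesis by (simp add: x_def)
qed

text \<open>The products of the one-dimensional dual weights are dual to the columns, so they recover each \<open>c n\<close>.\<close>

lemma separable_sampling_injective:
  fixes M :: "nat ^ 'd" and e :: "'d \<Rightarrow> int \<Rightarrow> real"
  assumes inj: "\<And>k. inj_on (node M e k) {0..<int (M $ k)}"
    and zero: "\<And>j. j \<in> Omega M \<Longrightarrow> (\<Sum>m\<in>Omega M. sampling M (\<lambda>j k. e k (j $ k)) j m * c m) = 0"
    and n: "n \<in> Omega M"
  shows "c n = 0"
proof -
  have "\<exists>w. \<forall>n r. n < M $ k \<longrightarrow> (\<Sum>j\<in>{0..<int (M $ k)}. w r j * node M e k j ^ n) = (if r = n then 1 else 0)" for k
    using vandermonde_left_inverse[of "{0..<int (M $ k)}" "node M e k"] inj[of k] by (metis card_atLeastLessThan_int diff_zero finite_atLeastLessThan_int nat_int)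
  then obtain w where w: "\<And>k n r. n < M $ k \<Longrightarrow> (\<Sum>j\<in>{0..<int (M $ k)}. w k r j * node M e k j ^ n) = (if r = n then 1 else 0)"
    by metis
  define W where "W = (\<lambda>j. \<Prod>k\<in>UNIV. w k (nat (n $ k)) (j $ k))"
  have dual: "(\<Sum>j\<in>Omega M. W j * sampling M (\<lambda>j k. e k (j $ k)) j m) = (if m = n then 1 else 0)" if m: "m \<in> Omega M" for m
  proof -
    have "(\<Sum>j\<in>Omega M. W j * sampling M (\<lambda>j k. e k (j $ k)) j m)
       = (\<Prod>k\<in>UNIV. \<Sum>v\<in>{0..<int (M $ k)}. w k (nat (n $ k)) v * node M e k v ^ nat (m $ k))"
      unfolding W_def sampling_eq_node_powers[OF m] prod.distrib[symmetric] by (rule sum_Omega_prod)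
    also have "\<dots> = (\<Prod>k\<in>UNIV. if nat (n $ k) = nat (m $ k) then 1 else 0)"
      using m by (intro prod.cong refl w) (simp add: mem_Omega_iff nat_less_iff)
    also have "\<dots> = (if m = n then 1 else 0)"
    proof (cases "m = n")
      case False
      then obtain k where "m $ k \<noteq> n $ k" by (auto simp: Finite_Cartesian_Product.vec_eq_iff)
      then have "nat (n $ k) \<noteq> nat (m $ k)" using m n by (auto simp: mem_Omega_iff eq_nat_nat_iff)
      then show ?thesis using False by (auto intro!: prod_zero)
    qed simp
    finally show ?thesis .
  qed
  have "0 = (\<Sum>j\<in>Omega M. W j * (\<Sum>m\<in>Omega M. sampling M (\<lambda>j k. e k (j $ k)) j m * c m))"
    using zero by simp
  also have "\<dots> = (\<Sum>j\<in>Omega M. \<Sum>m\<in>Omega M. (W j * sampling M (\<lambda>j k. e k (j $ k)) j m) * c m)"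
    by (simp add: sum_distrib_left mult.assoc)
  also have "\<dots> = (\<Sum>m\<in>Omega M. (\<Sum>j\<in>Omega M. W j * sampling M (\<lambda>j k. e k (j $ k)) j m) * c m)"
    unfolding sum_distrib_right by (rule sum.swap)
  also have "\<dots> = (\<Sum>m\<in>Omega M. if m = n then c n else 0)"
    by (intro sum.cong refl) (simp add: dual)
  also have "\<dots> = c n" using n by (simp add: finite_Omega)
  finally show ?thesis by simp
qed


section \<open>Singular values as norm bounds\<close>

definition vnorm :: "complex vec \<Rightarrow> real" where
  "vnorm v = l2norm {..<dim_vec v} (\<lambda>i. vec_index v i)"

lemma vnorm_eq_0_iff:
  assumes "v \<in> carrier_vec n"
  shows "vnorm v = 0 \<longleftrightarrow> v = 0\<^sub>v n"
proof
  assume "vnorm v = 0"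
  then show "v = 0\<^sub>v n" using assms
    by (auto simp: vnorm_def l2norm_def L2_set_eq_0_iff intro!: eq_vecI)
qed (auto simp: vnorm_def l2norm_def L2_set_eq_0_iff)

lemma mat_adjoint_dims: "A \<in> carrier_mat m n \<Longrightarrow> mat_adjoint A * A \<in> carrier_mat n n"
  unfolding mat_adjoint_def by auto

text \<open>Pairing \<open>A* A v = k v\<close> with \<open>v\<close> gives \<open>k \<parallel>v\<parallel>\<^sup>2 = \<parallel>A v\<parallel>\<^sup>2\<close>; in particular \<open>k\<close> is real and
  nonnegative, and its root is a singular value.\<close>

lemma eigenvalue_adjoint_norm:
  assumes A: "A \<in> carrier_mat m n" and v: "v \<in> carrier_vec n"
    and ev: "(mat_adjoint A * A) *\<^sub>v v = k \<cdot>\<^sub>v v"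
  shows "k * of_real ((vnorm v)\<^sup>2) = of_real ((vnorm (A *\<^sub>v v))\<^sup>2)"
proof -
  define w where "w = A *\<^sub>v v"
  have w: "dim_vec w = m" using A by (simp add: w_def)
  have adj: "mat_adjoint A \<in> carrier_mat n m" using A unfolding mat_adjoint_def by auto
  have wr: "vec_index w r = (\<Sum>i<n. A $$ (r, i) * vec_index v i)" if "r < m" for r
    using that A v by (auto simp: w_def scalar_prod_def lessThan_atLeast0 intro!: sum.cong)
  have aw: "k * vec_index v i = (\<Sum>r<m. cnj (A $$ (r, i)) * vec_index w r)" if i: "i < n" for i
  proof -
    have "(mat_adjoint A * A) *\<^sub>v v = mat_adjoint A *\<^sub>v w"
      unfolding w_def by (rule assoc_mult_mat_vec[OF adj A v])
    with ev have "k * vec_index v i = vec_index (mat_adjoint A *\<^sub>v w) i"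
      using i v by (metis carrier_vecD index_smult_vec(1))
    also have "\<dots> = (\<Sum>r<m. cnj (A $$ (r, i)) * vec_index w r)"
      using i A w adj by (auto simp: scalar_prod_def lessThan_atLeast0 mat_adjoint_def conjugate_complex_def intro!: sum.cong)
    finally show ?thesis .
  qed
  have "k * of_real ((vnorm v)\<^sup>2) = (\<Sum>i<n. (k * vec_index v i) * cnj (vec_index v i))"
    using v by (simp add: vnorm_def l2norm_power2 complex_norm_square sum_distrib_left mult.assoc del: of_real_power)
  also have "\<dots> = (\<Sum>i<n. \<Sum>r<m. vec_index w r * cnj (A $$ (r, i) * vec_index v i))"
    by (intro sum.cong refl) (simp add: aw sum_distrib_left sum_distrib_right mult_ac)
  also have "\<dots> = (\<Sum>r<m. \<Sum>i<n. vec_index w r * cnj (A $$ (r, i) * vec_index v i))" by (rule sum.swap)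
  also have "\<dots> = (\<Sum>r<m. vec_index w r * cnj (vec_index w r))"
    by (intro sum.cong refl) (simp add: wr sum_distrib_left cnj_sum)
  also have "\<dots> = of_real ((vnorm w)\<^sup>2)"
    using w by (simp add: vnorm_def l2norm_power2 complex_norm_square del: of_real_power)
  finally show ?thesis by (simp add: w_def)
qed

lemma singular_value_attained:
  assumes A: "A \<in> carrier_mat m n" and s: "s \<in> singular_values A"
  obtains v where "v \<in> carrier_vec n" "v \<noteq> 0\<^sub>v n" "s * vnorm v = vnorm (A *\<^sub>v v)"
proof -
  from s obtain v where s0: "0 \<le> s" and v: "v \<in> carrier_vec n" "v \<noteq> 0\<^sub>v n"
    and ev: "(mat_adjoint A * A) *\<^sub>v v = complex_of_real (s\<^sup>2) \<cdot>\<^sub>v v"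
    using mat_adjoint_dims[OF A] by (auto simp: singular_values_def eigenvalue_def eigenvector_def)
  from eigenvalue_adjoint_norm[OF A v(1) ev]
  have "(s * vnorm v)\<^sup>2 = (vnorm (A *\<^sub>v v))\<^sup>2"
    by (simp only: of_real_mult[symmetric] of_real_eq_iff power_mult_distrib)
  then have "s * vnorm v = vnorm (A *\<^sub>v v)"
    by (rule power2_eq_imp_eq) (use s0 in \<open>simp_all add: vnorm_def\<close>)
  with v show thesis by (rule that)
qed

lemma singular_values_finite_nonempty:
  assumes A: "A \<in> carrier_mat m n" and n: "0 < n"
  shows "finite (singular_values A)" "singular_values A \<noteq> {}"
proof -
  let ?B = "mat_adjoint A * A"
  have B: "?B \<in> carrier_mat n n" by (rule mat_adjoint_dims[OF A])
  have deg: "degree (char_poly ?B) = n" using degree_monic_char_poly[OF B] by simp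
  then have "char_poly ?B \<noteq> 0" using n by auto
  then have finite_ev: "finite {k. eigenvalue ?B k}"
    unfolding eigenvalue_root_char_poly[OF B] by (rule poly_roots_finite)
  show "finite (singular_values A)"
  proof (rule finite_imageD)
    show "finite ((\<lambda>s. complex_of_real (s\<^sup>2)) ` singular_values A)"
      by (rule finite_subset[OF _ finite_ev]) (auto simp: singular_values_def)
    show "inj_on (\<lambda>s. complex_of_real (s\<^sup>2)) (singular_values A)"
      by (intro inj_onI) (auto simp: singular_values_def simp del: of_real_power)
  qed
  have "\<not> constant (poly (char_poly ?B))" using deg n by (simp add: constant_degree)
  then obtain k where k: "eigenvalue ?B k"
    using fundamental_theorem_of_algebra eigenvalue_root_char_poly[OF B] by blast
  then obtain v where v: "v \<in> carrier_vec n" "v \<noteq> 0\<^sub>v n" and ev: "?B *\<^sub>v v = k \<cdot>\<^sub>v v"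
    using B by (auto simp: eigenvalue_def eigenvector_def)
  define s where "s = vnorm (A *\<^sub>v v) / vnorm v"
  have "vnorm v \<noteq> 0" using vnorm_eq_0_iff v by blast
  then have "k = complex_of_real (s\<^sup>2)"
    using eigenvalue_adjoint_norm[OF A v(1) ev] by (simp add: s_def power_divide field_simps)
  moreover have "0 \<le> s" by (simp add: s_def vnorm_def)
  ultimately show "singular_values A \<noteq> {}" using k by (auto simp: singular_values_def)
qed

text \<open>Both extreme singular values are quotients \<open>\<parallel>A v\<parallel> / \<parallel>v\<parallel>\<close> for suitable \<open>v \<noteq> 0\<close>, hence obey every bound
  that holds for all vectors.\<close>

lemma sigma_bounds:
  assumes A: "A \<in> carrier_mat m n" and n: "0 < n"
  shows "(\<And>v. v \<in> carrier_vec n \<Longrightarrow> a * vnorm v \<le> vnorm (A *\<^sub>v v)) \<Longrightarrow> a \<le> sigma_min A"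
    and "(\<And>v. v \<in> carrier_vec n \<Longrightarrow> vnorm (A *\<^sub>v v) \<le> b * vnorm v) \<Longrightarrow> sigma_max A \<le> b"
    and "(\<And>v. v \<in> carrier_vec n \<Longrightarrow> vnorm (A *\<^sub>v v) = 0 \<Longrightarrow> v = 0\<^sub>v n) \<Longrightarrow> 0 < sigma_min A"
proof -
  note sv = singular_values_finite_nonempty[OF A n]
  have pos: "0 < vnorm v" if "v \<in> carrier_vec n" "v \<noteq> 0\<^sub>v n" for v
    using vnorm_eq_0_iff that by (metis l2norm_nonneg less_eq_real_def vnorm_def)
  have min: "sigma_min A \<in> singular_values A" unfolding sigma_min_def by (rule Min_in[OF sv])
  have max: "sigma_max A \<in> singular_values A" unfolding sigma_max_def by (rule Max_in[OF sv])
  obtain v where v: "v \<in> carrier_vec n" "v \<noteq> 0\<^sub>v n" "sigma_min A * vnorm v = vnorm (A *\<^sub>v v)"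
    using singular_value_attained[OF A min] .
  obtain u where u: "u \<in> carrier_vec n" "u \<noteq> 0\<^sub>v n" "sigma_max A * vnorm u = vnorm (A *\<^sub>v u)"
    using singular_value_attained[OF A max] .
  show "a \<le> sigma_min A" if "\<And>v. v \<in> carrier_vec n \<Longrightarrow> a * vnorm v \<le> vnorm (A *\<^sub>v v)"
    using that[OF v(1)] v pos[OF v(1,2)] by (metis mult_le_cancel_right_pos)
  show "sigma_max A \<le> b" if "\<And>v. v \<in> carrier_vec n \<Longrightarrow> vnorm (A *\<^sub>v v) \<le> b * vnorm v"
    using that[OF u(1)] u pos[OF u(1,2)] by (metis mult_le_cancel_right_pos)
  show "0 < sigma_min A" if "\<And>v. v \<in> carrier_vec n \<Longrightarrow> vnorm (A *\<^sub>v v) = 0 \<Longrightarrow> v = 0\<^sub>v n"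
  proof -
    have "sigma_min A \<noteq> 0" using that[OF v(1)] v by auto
    moreover have "0 \<le> sigma_min A" using min by (simp add: singular_values_def)
    ultimately show ?thesis by simp
  qed
qed

lemma invertible_iff_injective:
  fixes A :: "complex mat"
  assumes A: "A \<in> carrier_mat n n"
  shows "invertible_mat A \<longleftrightarrow> (\<forall>v \<in> carrier_vec n. A *\<^sub>v v = 0\<^sub>v n \<longrightarrow> v = 0\<^sub>v n)"
proof
  assume "invertible_mat A"
  then obtain B where BA: "B * A = 1\<^sub>m (dim_row B)" and AB: "A * B = 1\<^sub>m n"
    using A by (auto simp: invertible_mat_def inverts_mat_def)
  have B: "B \<in> carrier_mat n n"
  proof -
    have "dim_col B = n" using arg_cong[OF AB, of dim_col] by simp
    moreover have "dim_row B = n" using arg_cong[OF BA, of dim_col] A by simp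
    ultimately show ?thesis by auto
  qed
  show "\<forall>v \<in> carrier_vec n. A *\<^sub>v v = 0\<^sub>v n \<longrightarrow> v = 0\<^sub>v n"
  proof (intro ballI impI)
    fix v assume v: "v \<in> carrier_vec n" "A *\<^sub>v v = 0\<^sub>v n"
    have "v = (B * A) *\<^sub>v v" using BA B v by simp
    also have "\<dots> = B *\<^sub>v (A *\<^sub>v v)" using assoc_mult_mat_vec[OF B A v(1)] .
    also have "\<dots> = 0\<^sub>v n" using v B by (auto simp: scalar_prod_def intro!: eq_vecI)
    finally show "v = 0\<^sub>v n" .
  qed
next
  assume inj: "\<forall>v \<in> carrier_vec n. A *\<^sub>v v = 0\<^sub>v n \<longrightarrow> v = 0\<^sub>v n"
  then have "det A \<noteq> 0" using det_0_iff_vec_prod_zero_field[OF A] by blast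
  from det_non_zero_imp_unit[OF A this, of "()"]
  obtain B where "B \<in> carrier_mat n n" "B * A = 1\<^sub>m n" "A * B = 1\<^sub>m n"
    by (auto simp: Units_def ring_mat_def)
  then show "invertible_mat A" using A by (auto simp: invertible_mat_def inverts_mat_def)
qed

section \<open>Fourier matrices as sampling kernels\<close>

definition grid_point :: "nat ^ 'd \<Rightarrow> int ^ 'd \<Rightarrow> real ^ 'd" where
  "grid_point M m = (\<chi> k. real_of_int (m $ k) / real (M $ k))"

lemma scaled_Omega_eq: "scaled_Omega M = grid_point M ` Omega M"
  by (simp add: scaled_Omega_def grid_point_def[abs_def])

lemma inj_grid_point:
  assumes "\<And>k. 1 \<le> M $ k"
  shows "inj (grid_point M)"
proof (rule injI)
  fix m n assume eq: "grid_point M m = grid_point M n"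
  have "m $ k = n $ k" for k
  proof -
    have "grid_point M m $ k = grid_point M n $ k" using eq by simp
    then show ?thesis using assms[of k] by (simp add: grid_point_def)
  qed
  then show "m = n" by (simp add: Finite_Cartesian_Product.vec_eq_iff)
qed

lemma fourier_entry_eq_sampling:
  "exp (2 * of_real pi * \<i> * of_real ((of_int_vec j + \<epsilon> j) \<bullet> grid_point M m)) = sampling M (\<lambda>j k. \<epsilon> j $ k) j m"
proof -
  have "2 * complex_of_real pi * \<i> * of_real ((of_int_vec j + \<epsilon> j) \<bullet> grid_point M m)
     = (\<Sum>k\<in>UNIV. \<i> * of_real (2 * pi * (real_of_int (j $ k) + \<epsilon> j $ k) * real_of_int (m $ k) / real (M $ k)))"
    unfolding inner_vec_def of_real_sum sum_distrib_left
    by (intro sum.cong refl) (simp add: of_int_vec_def grid_point_def)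
  then show ?thesis by (simp add: exp_sum sampling_def cis_conv_exp)
qed

lemma fourier_mat_carrier: "fourier_mat \<epsilon> js us \<in> carrier_mat (length js) (length us)"
  by (simp add: fourier_mat_def)

lemma sum_zero_extension:
  fixes h :: "'m \<Rightarrow> 'z :: zero \<Rightarrow> 'b :: comm_monoid_add"
  assumes "finite Y" "inj_on p I" "p ` I \<subseteq> Y" "\<And>i. i \<in> I \<Longrightarrow> c (p i) = v i"
    and "\<And>m. m \<in> Y - p ` I \<Longrightarrow> c m = 0" "\<And>m. h m 0 = 0"
  shows "(\<Sum>m\<in>Y. h m (c m)) = (\<Sum>i\<in>I. h (p i) (v i))"
proof -
  have "(\<Sum>m\<in>Y. h m (c m)) = (\<Sum>m\<in>p ` I. h m (c m))"
    by (rule sum.mono_neutral_right[OF assms(1,3)]) (use assms(5,6) in auto)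
  also have "\<dots> = (\<Sum>i\<in>I. h (p i) (v i))"
    by (subst sum.reindex[OF assms(2)]) (simp add: assms(4))
  finally show ?thesis .
qed

text \<open>A vector indexed by the columns becomes a function on the box, extended by zero outside the chosen
  grid points; this is how an arbitrary set of columns is reduced to the full grid.\<close>

lemma fourier_mat_as_sampling:
  fixes M :: "nat ^ 'd"
  assumes M: "\<And>k. 1 \<le> M $ k" and U: "set us \<subseteq> scaled_Omega M"
    and js: "distinct js" "set js = Omega M" and us: "distinct us"
    and v: "v \<in> carrier_vec (length us)"
  obtains c where "vnorm v = l2norm (Omega M) c"
    and "vnorm (fourier_mat \<epsilon> js us *\<^sub>v v)
           = l2norm (Omega M) (\<lambda>j. \<Sum>m\<in>Omega M. sampling M (\<lambda>j k. \<epsilon> j $ k) j m * c m)"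
proof -
  define n where "n = length us"
  define p where "p = (\<lambda>i. inv_into (Omega M) (grid_point M) (us ! i))"
  have p: "p i \<in> Omega M" "grid_point M (p i) = us ! i" if "i < n" for i
  proof -
    have "us ! i \<in> grid_point M ` Omega M" using that U by (auto simp: n_def scaled_Omega_eq)
    then show "p i \<in> Omega M" "grid_point M (p i) = us ! i"
      unfolding p_def by (auto intro: inv_into_into f_inv_into_f)
  qed
  have inj: "inj_on p {..<n}"
  proof (rule inj_onI)
    fix i i' assume i: "i \<in> {..<n}" "i' \<in> {..<n}" "p i = p i'"
    then have "us ! i = us ! i'" using p(2)[of i] p(2)[of i'] by simp
    then show "i = i'" using i us by (simp add: n_def nth_eq_iff_index_eq)
  qed
  have sub: "p ` {..<n} \<subseteq> Omega M" using p by auto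
  define c where "c = (\<lambda>m. if m \<in> p ` {..<n} then vec_index v (inv_into {..<n} p m) else 0)"
  have c: "c (p i) = vec_index v i" if "i \<in> {..<n}" for i
    using that inj by (auto simp: c_def inv_into_f_f)
  have c0: "c m = 0" if "m \<in> Omega M - p ` {..<n}" for m
    using that by (auto simp: c_def)
  note transfer = sum_zero_extension[where Y = "Omega M" and I = "{..<n}" and p = p and c = c and v = "vec_index v",
      OF finite_Omega inj sub c c0]
  have dv: "dim_vec v = n" using v by (simp add: n_def)
  have "vnorm v = l2norm (Omega M) c"
  proof (rule power2_eq_imp_eq)
    show "(vnorm v)\<^sup>2 = (l2norm (Omega M) c)\<^sup>2"
      unfolding vnorm_def l2norm_power2 dv by (subst transfer[where h = "\<lambda>_ z. (cmod z)\<^sup>2"]) simp_all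
  qed (simp_all add: vnorm_def)
  moreover have "vnorm (fourier_mat \<epsilon> js us *\<^sub>v v)
       = l2norm (Omega M) (\<lambda>j. \<Sum>m\<in>Omega M. sampling M (\<lambda>j k. \<epsilon> j $ k) j m * c m)"
  proof (rule power2_eq_imp_eq)
    let ?G = "\<lambda>j. \<Sum>m\<in>Omega M. sampling M (\<lambda>j k. \<epsilon> j $ k) j m * c m"
    have entry: "vec_index (fourier_mat \<epsilon> js us *\<^sub>v v) r = ?G (js ! r)" if "r < length js" for r
    proof -
      have "vec_index (fourier_mat \<epsilon> js us *\<^sub>v v) r
         = (\<Sum>i<n. exp (2 * of_real pi * \<i> * of_real ((of_int_vec (js ! r) + \<epsilon> (js ! r)) \<bullet> us ! i)) * vec_index v i)"
        using that v by (auto simp: fourier_mat_def scalar_prod_def n_def lessThan_atLeast0 intro!: sum.cong)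
      also have "\<dots> = (\<Sum>i<n. sampling M (\<lambda>j k. \<epsilon> j $ k) (js ! r) (p i) * vec_index v i)"
        by (intro sum.cong refl) (simp add: p(2)[symmetric] fourier_entry_eq_sampling)
      also have "\<dots> = ?G (js ! r)"
        by (subst transfer[where h = "\<lambda>m z. sampling M (\<lambda>j k. \<epsilon> j $ k) (js ! r) m * z"]) simp_all
      finally show ?thesis .
    qed
    have "(vnorm (fourier_mat \<epsilon> js us *\<^sub>v v))\<^sup>2 = (\<Sum>r<length js. (cmod (?G (js ! r)))\<^sup>2)"
      unfolding vnorm_def l2norm_power2
      by (rule sum.cong) (use fourier_mat_carrier[of \<epsilon> js us] entry in auto)
    also have "\<dots> = (\<Sum>j\<in>Omega M. (cmod (?G j))\<^sup>2)"
      by (rule sum.reindex_bij_betw) (use bij_betw_nth[OF js(1) refl js(2)[symmetric]] in simp)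
    finally show "(vnorm (fourier_mat \<epsilon> js us *\<^sub>v v))\<^sup>2 = (l2norm (Omega M) ?G)\<^sup>2"
      by (simp add: l2norm_power2)
  qed (simp_all add: vnorm_def)
  ultimately show thesis by (rule that)
qed

lemma abs_le_sup_norm:
  assumes "j \<in> Omega M"
  shows "\<bar>\<epsilon> j $ k\<bar> \<le> sup_norm M \<epsilon>"
  unfolding sup_norm_def
proof (rule Max_ge)
  have "{\<bar>\<epsilon> j $ k\<bar> | j k. j \<in> Omega M} = (\<lambda>(j, k). \<bar>\<epsilon> j $ k\<bar>) ` (Omega M \<times> UNIV)" by auto
  then show "finite {\<bar>\<epsilon> j $ k\<bar> | j k. j \<in> Omega M}" by (simp add: finite_Omega)
qed (use assms in auto)

lemma sampling_cong:
  "(\<And>k. \<theta> j k = \<theta>' j k) \<Longrightarrow> sampling M \<theta> j m = sampling M \<theta>' j m"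
  by (simp add: sampling_def)

lemma single_coordinate_mem_Omega:
  assumes "\<And>k. 1 \<le> M $ k" "0 \<le> v" "v < int (M $ k)"
  shows "(\<chi> i. if i = k then v else 0) \<in> Omega M"
  using assms by (auto simp: mem_Omega_iff Suc_le_eq)

theorem theorem3p2:
  fixes M :: "nat ^ 'd"
    and U :: "(real ^ 'd) set"
    and \<epsilon> :: "int ^ 'd \<Rightarrow> real ^ 'd"
    and js :: "(int ^ 'd) list"
    and us :: "(real ^ 'd) list"
  assumes "\<forall>k. 1 \<le> M $ k"
    and "U \<subseteq> scaled_Omega M"
    and "U \<noteq> {}"
    and "distinct js" and "set js = Omega M"
    and "distinct us" and "set us = U"
  shows
    "(sup_norm M \<epsilon> < 1 / 4 \<longrightarrow>
        sigma_min (fourier_mat \<epsilon> js us)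
          \<ge> (1 - D_fun CARD('d) (sup_norm M \<epsilon>)) * sqrt (\<Prod>k\<in>UNIV. real (M $ k)) \<and>
        sigma_max (fourier_mat \<epsilon> js us)
          \<le> (1 + D_fun CARD('d) (sup_norm M \<epsilon>)) * sqrt (\<Prod>k\<in>UNIV. real (M $ k)))
   \<and> (sup_norm M \<epsilon> < 1 / 4 \<and> rank_one M \<epsilon> \<longrightarrow>
        sigma_min (fourier_mat \<epsilon> js us)
          \<ge> (1 - C_fun (sup_norm M \<epsilon>)) ^ CARD('d) * sqrt (\<Prod>k\<in>UNIV. real (M $ k)) \<and>
        sigma_max (fourier_mat \<epsilon> js us)
          \<le> (1 + C_fun (sup_norm M \<epsilon>)) ^ CARD('d) * sqrt (\<Prod>k\<in>UNIV. real (M $ k)))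
   \<and> (\<forall>e. rank_one_with M \<epsilon> e \<longrightarrow>
        (U = scaled_Omega M \<longrightarrow>
          (invertible_mat (fourier_mat \<epsilon> js us) \<longleftrightarrow>
            (\<forall>i \<in> Omega M. \<forall>j \<in> Omega M. \<forall>k. i $ k \<noteq> j $ k \<longrightarrow>
              1 / real (M $ k) * (real_of_int (j $ k) - real_of_int (i $ k)
                 + e k (j $ k) - e k (i $ k)) \<notin> \<int>))) \<and>
        ((\<forall>i \<in> Omega M. \<forall>j \<in> Omega M. \<forall>k. i $ k \<noteq> j $ k \<longrightarrow>
            1 / real (M $ k) * (real_of_int (j $ k) - real_of_int (i $ k)
               + e k (j $ k) - e k (i $ k)) \<notin> \<int>) \<longrightarrow>
          0 < sigma_min (fourier_mat \<epsilon> js us)))"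
proof (intro conjI allI impI)
  let ?F = "fourier_mat \<epsilon> js us"
  let ?l = "sup_norm M \<epsilon>"
  have M: "1 \<le> M $ k" for k using assms(1) by simp
  have us0: "0 < length us" using assms(3,7) by auto
  note sigma = sigma_bounds[OF fourier_mat_carrier[of \<epsilon> js us] us0]
  have zero_mem: "(\<chi> k. 0) \<in> Omega M" using M by (auto simp: mem_Omega_iff Suc_le_eq)
  have l0: "0 \<le> ?l" using abs_le_sup_norm[OF zero_mem, of \<epsilon>] abs_ge_zero order_trans by blast
  have as_sampling: "\<exists>c. vnorm v = l2norm (Omega M) c \<and> vnorm (?F *\<^sub>v v)
       = l2norm (Omega M) (\<lambda>j. \<Sum>m\<in>Omega M. sampling M (\<lambda>j k. \<epsilon> j $ k) j m * c m)"
    if "v \<in> carrier_vec (length us)" for v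
    using fourier_mat_as_sampling[where \<epsilon> = \<epsilon>, OF M _ assms(4,5,6) that] assms(2,7) by blast
  {
    assume l: "?l < 1 / 4"
    have "(1 - D_fun CARD('d) ?l) * sqrt (\<Prod>k\<in>UNIV. real (M $ k)) * vnorm v \<le> vnorm (?F *\<^sub>v v) \<and>
        vnorm (?F *\<^sub>v v) \<le> (1 + D_fun CARD('d) ?l) * sqrt (\<Prod>k\<in>UNIV. real (M $ k)) * vnorm v"
      if v: "v \<in> carrier_vec (length us)" for v
    proof -
      obtain c where "vnorm v = l2norm (Omega M) c" "vnorm (?F *\<^sub>v v)
          = l2norm (Omega M) (\<lambda>j. \<Sum>m\<in>Omega M. sampling M (\<lambda>j k. \<epsilon> j $ k) j m * c m)"
        using as_sampling[OF v] by blast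
      then show ?thesis
        using sampling_bounds[of M ?l "\<lambda>j k. \<epsilon> j $ k" c] M l0 l abs_le_sup_norm[of _ M \<epsilon>]
        by (simp add: mult.assoc)
    qed
    then show "(1 - D_fun CARD('d) ?l) * sqrt (\<Prod>k\<in>UNIV. real (M $ k)) \<le> sigma_min ?F"
      "sigma_max ?F \<le> (1 + D_fun CARD('d) ?l) * sqrt (\<Prod>k\<in>UNIV. real (M $ k))"
      by (auto intro!: sigma(1,2))
  }
  have separable: "sampling M (\<lambda>j k. \<epsilon> j $ k) j m = sampling M (\<lambda>j k. e k (j $ k)) j m"
    if "rank_one_with M \<epsilon> e" "j \<in> Omega M" for e j m
    by (rule sampling_cong) (use that in \<open>simp add: rank_one_with_def\<close>)
  have as_separable: "\<exists>c. vnorm v = l2norm (Omega M) c \<and> vnorm (?F *\<^sub>v v)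
       = l2norm (Omega M) (\<lambda>j. \<Sum>m\<in>Omega M. sampling M (\<lambda>j k. e k (j $ k)) j m * c m)"
    if e: "rank_one_with M \<epsilon> e" and v: "v \<in> carrier_vec (length us)" for e v
  proof -
    obtain c where c: "vnorm v = l2norm (Omega M) c" "vnorm (?F *\<^sub>v v)
       = l2norm (Omega M) (\<lambda>j. \<Sum>m\<in>Omega M. sampling M (\<lambda>j k. \<epsilon> j $ k) j m * c m)"
      using as_sampling[OF v] by blast
    have "l2norm (Omega M) (\<lambda>j. \<Sum>m\<in>Omega M. sampling M (\<lambda>j k. \<epsilon> j $ k) j m * c m)
       = l2norm (Omega M) (\<lambda>j. \<Sum>m\<in>Omega M. sampling M (\<lambda>j k. e k (j $ k)) j m * c m)"
      by (intro l2norm_cong arg_cong[of _ _ cmod] sum.cong refl) (simp add: separable[OF e])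
    with c show ?thesis by auto
  qed
  {
    assume "?l < 1 / 4 \<and> rank_one M \<epsilon>"
    then obtain e where l: "?l < 1 / 4" and e: "rank_one_with M \<epsilon> e" by (auto simp: rank_one_def)
    have small: "\<bar>e k v\<bar> \<le> ?l" if "0 \<le> v" "v < int (M $ k)" for k v
    proof -
      have mem: "(\<chi> i. if i = k then v else 0) \<in> Omega M" by (rule single_coordinate_mem_Omega[OF M that])
      then have "\<epsilon> (\<chi> i. if i = k then v else 0) $ k = e k v" using e by (simp add: rank_one_with_def)
      with abs_le_sup_norm[OF mem, of \<epsilon> k] show ?thesis by simp
    qed
    have "(1 - C_fun ?l) ^ CARD('d) * sqrt (\<Prod>k\<in>UNIV. real (M $ k)) * vnorm v \<le> vnorm (?F *\<^sub>v v) \<and>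
        vnorm (?F *\<^sub>v v) \<le> (1 + C_fun ?l) ^ CARD('d) * sqrt (\<Prod>k\<in>UNIV. real (M $ k)) * vnorm v"
      if v: "v \<in> carrier_vec (length us)" for v
    proof -
      obtain c where "vnorm v = l2norm (Omega M) c" "vnorm (?F *\<^sub>v v)
          = l2norm (Omega M) (\<lambda>j. \<Sum>m\<in>Omega M. sampling M (\<lambda>j k. e k (j $ k)) j m * c m)"
        using as_separable[OF e v] by blast
      then show ?thesis
        using separable_sampling_bounds[of M ?l e c] M l0 l small by (simp add: mult.assoc)
    qed
    then show "(1 - C_fun ?l) ^ CARD('d) * sqrt (\<Prod>k\<in>UNIV. real (M $ k)) \<le> sigma_min ?F"
      "sigma_max ?F \<le> (1 + C_fun ?l) ^ CARD('d) * sqrt (\<Prod>k\<in>UNIV. real (M $ k))"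
      by (auto intro!: sigma(1,2))
  }
  fix e assume e: "rank_one_with M \<epsilon> e"
  let ?cond = "\<forall>i \<in> Omega M. \<forall>j \<in> Omega M. \<forall>k. i $ k \<noteq> j $ k \<longrightarrow>
              1 / real (M $ k) * (real_of_int (j $ k) - real_of_int (i $ k)
                 + e k (j $ k) - e k (i $ k)) \<notin> \<int>"
  have injective: "v = 0\<^sub>v (length us)"
    if cond: ?cond and v: "v \<in> carrier_vec (length us)" "vnorm (?F *\<^sub>v v) = 0" for v
  proof -
    obtain c where c: "vnorm v = l2norm (Omega M) c" "vnorm (?F *\<^sub>v v)
       = l2norm (Omega M) (\<lambda>j. \<Sum>m\<in>Omega M. sampling M (\<lambda>j k. e k (j $ k)) j m * c m)"
      using as_separable[OF e v(1)] by blast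
    have "c n = 0" if "n \<in> Omega M" for n
    proof (rule separable_sampling_injective[OF _ _ that])
      show "inj_on (node M e k) {0..<int (M $ k)}" for k
      proof (rule inj_onI, rule ccontr)
        fix a b assume ab: "a \<in> {0..<int (M $ k)}" "b \<in> {0..<int (M $ k)}" "node M e k a = node M e k b" "a \<noteq> b"
        \<comment> \<open>Two coordinate values are realized by points of the box that vanish in all other coordinates.\<close>
        define i where "i = (\<chi> r. if r = k then b else 0)"
        define j where "j = (\<chi> r. if r = k then a else 0)"
        have "i \<in> Omega M" "j \<in> Omega M" "i $ k = b" "j $ k = a"
          using ab single_coordinate_mem_Omega[OF M] by (auto simp: i_def j_def)
        with cond ab(4) have "1 / real (M $ k) * (real_of_int a - real_of_int b + e k a - e k b) \<notin> \<int>"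
          by metis
        with ab(3) node_eq_iff[OF M] show False by blast
      qed
      show "(\<Sum>m\<in>Omega M. sampling M (\<lambda>j k. e k (j $ k)) j m * c m) = 0" if "j \<in> Omega M" for j
        using c(2) v(2) that by (simp add: l2norm_def L2_set_eq_0_iff finite_Omega)
    qed
    then have "vnorm v = 0" using c(1) by (simp add: l2norm_def L2_set_eq_0_iff finite_Omega)
    then show ?thesis using vnorm_eq_0_iff[OF v(1)] by simp
  qed
  show "0 < sigma_min ?F" if ?cond
    by (rule sigma(3)) (rule injective[OF that])
  show "invertible_mat ?F \<longleftrightarrow> ?cond" if full: "U = scaled_Omega M"
  proof
    have "card (set us) = card (Omega M)"
      unfolding assms(7) full scaled_Omega_eq
      by (intro card_image inj_on_subset[OF inj_grid_point]) (use M in auto)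
    then have len: "length js = length us" using assms(4-6) by (metis distinct_card)
    have sq: "?F \<in> carrier_mat (length us) (length us)" using fourier_mat_carrier[of \<epsilon> js us] len by simp
    show "invertible_mat ?F" if ?cond
      unfolding invertible_iff_injective[OF sq]
    proof (intro ballI impI)
      fix v assume v: "v \<in> carrier_vec (length us)" "?F *\<^sub>v v = 0\<^sub>v (length us)"
      show "v = 0\<^sub>v (length us)"
        by (rule injective[OF that v(1)]) (use v(2) in \<open>simp add: vnorm_def l2norm_def L2_set_0'\<close>)
    qed
    show ?cond if inv: "invertible_mat ?F"
    proof (intro ballI allI impI notI)
      fix i j k assume ij: "i \<in> Omega M" "j \<in> Omega M" "i $ k \<noteq> j $ k"
        and int: "1 / real (M $ k) * (real_of_int (j $ k) - real_of_int (i $ k) + e k (j $ k) - e k (i $ k)) \<in> \<int>"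
      \<comment> \<open>Exchanging only coordinate \<open>k\<close> of \<open>i\<close> gives a different row index with the same nodes.\<close>
      define i' where "i' = (\<chi> r. if r = k then j $ k else i $ r)"
      have i': "i' \<in> Omega M" "i' \<noteq> i"
        using ij by (auto simp: i'_def mem_Omega_iff Finite_Cartesian_Product.vec_eq_iff)
      obtain a b where ab: "a < length us" "b < length us" "js ! a = i" "js ! b = i'"
        using ij(1) i'(1) assms(5) len by (metis in_set_conv_nth)
      have "a \<noteq> b" using ab i'(2) by auto
      have rows: "row ?F a = row ?F b"
      proof (rule eq_vecI)
        fix q assume "q < dim_vec (row ?F b)"
        then have q: "q < length us" by (simp add: fourier_mat_def)
        then have "us ! q \<in> scaled_Omega M" using assms(2,7) by auto
        then obtain m where m: "m \<in> Omega M" "us ! q = grid_point M m" by (auto simp: scaled_Omega_eq)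
        have ent: "vec_index (row ?F r) q = (\<Prod>k\<in>UNIV. node M e k (js ! r $ k) ^ nat (m $ k))"
          if "r < length us" "js ! r \<in> Omega M" for r
          using that q len m separable[OF e that(2), of m]
          by (simp add: fourier_mat_def fourier_entry_eq_sampling sampling_eq_node_powers)
        have "node M e r (i $ r) = node M e r (i' $ r)" for r
          using node_eq_iff[OF M, of e k "j $ k" "i $ k"] int by (simp add: i'_def)
        then show "vec_index (row ?F a) q = vec_index (row ?F b) q"
          using ent ab ij(1) i'(1) by simp
      qed (simp add: fourier_mat_def)
      obtain B where AB: "?F * B = 1\<^sub>m (length us)"
        using inv sq by (auto simp: invertible_mat_def inverts_mat_def)
      have "dim_col B = length us" using arg_cong[OF AB, of dim_col] by simp
      then have "(?F * B) $$ (a, a) = (?F * B) $$ (b, a)"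
        using ab sq rows by simp
      then show False unfolding AB using ab \<open>a \<noteq> b\<close> by simp
    qed
  qed
qed

end
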